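(* (1) The succession set statistic $\mathrm{Succ}$ is weakly shuffle-compatible on set partitions. (2) Let $\{T_\alpha\}_\alpha$ be a tie basis of $\mathrm{QSym}$. The linear map on $\mathcal{A}^{\Pi}_{\mathrm{Succ}}$ defined by $[\pi]^\Pi_{\mathrm{Succ}}\mapsto T_{\mathrm{Comp}(\mathrm{Succ}(\pi))}$ is an algebra isomorphism between $\mathcal{A}^{\Pi}_{\mathrm{Succ}}$ and $\mathrm{QSym}$.
   Context: All algebras are over $\mathbb{Q}$. $\Pi_n$ is the set of set partitions of $[n]=\{1,\dots,n\}$, and $\Pi=\bigcup_{n\ge0}\Pi_n$; $|\pi|=n$ for $\pi\in\Pi_n$. For $\pi$ a set partition of $\{i_1<\dots<i_n\}$ and $S=\{s_1<\dots<s_n\}$, $\mathrm{shift}_S(\pi)$ is the set partition of $S$ obtained by replacing each $i_j$ by $s_j$. For $\tau\in\Pi_n,\theta\in\Pi_m$, the shifted arc-shuffle is the multiset (indexed by $S$) $\overrightarrow{\mathrm{ASh}}(\tau,\theta)=\{\{\mathrm{shift}_S(\tau)\cup\mathrm{shift}_{[n+m]\setminus S}(\theta): S\subseteq[n+m],|S|=n\}\}$. The succession set of $\pi\in\Pi_n$ is $\mathrm{Succ}(\pi)=\{i\in[n-1]: i,i+1\text{ lie in the same block of }\pi\}$. A statistic $\mathrm{st}$ on $\Pi$ is weakly shuffle-compatible on set partitions if for all $\tau,\theta\in\Pi$ the multiset $\{\{\mathrm{st}(\pi):\pi\in\overrightarrow{\mathrm{ASh}}(\tau,\theta)\}\}$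 is determined by $\mathrm{st}(\tau),\mathrm{st}(\theta),|\tau|,|\theta|$. Let $[\pi]^\Pi_{\mathrm{st}}=\{\tau\in\Pi:\mathrm{st}(\tau)=\mathrm{st}(\pi),|\tau|=|\pi|\}$. $\mathcal{A}^\Pi_{\mathrm{st}}$ is the algebra with basis these classes and product $[\tau]^\Pi_{\mathrm{st}}[\theta]^\Pi_{\mathrm{st}}=\sum_{\pi\in\overrightarrow{\mathrm{ASh}}(\tau,\theta)}[\pi]^\Pi_{\mathrm{st}}$ (with multiplicity). For $S=\{s_1<\dots<s_k\}\subseteq[n-1]$, $\mathrm{Comp}(S)=(s_1,s_2-s_1,\dots,s_k-s_{k-1},n-s_k)$, a composition of $n$ ($n=|\pi|$ above); $\mathrm{Set}$ is the inverse bijection from compositions of $n$ to subsets of $[n-1]$. For a word (finite sequence of positive integers) $v$ of length $n$, $\mathrm{Tie}(v)=\{i\in[n-1]:v_i=v_{i+1}\}$. For a composition $\alpha$ of $n$, the tie word $w^{\mathrm{Tie}}_\alpha=(w_1,\dots,w_n)$ has $w_1=1$ and for $1\le i\le n-1$: $w_{i+1}=w_i$ if $i\in\mathrm{Set}(\alpha)$, $w_{i+1}=w_i+1$ otherwise. A tie basis of $\mathrm{QSym}$ (the algebra of quasisymmetric functions) is a basis $\{T_\alpha\}$ indexed by integer compositions (including the empty one) with $T_\alpha T_\beta=\sum_v T_{\mathrm{Comp}(\mathrm{Tie}(v))}$, the sum over all interleavings $v$ of $w^{\mathrm{Tie}}_\alpha$ with the word obtained from $w^{\mathrm{Tie}}_\beta$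 by adding the largest letter of $w^{\mathrm{Tie}}_\alpha$ to each letter (so that the two words are disjoint). Such a basis exists and is fixed. *)

theory Defs
  imports
    "HOL-Library.Disjoint_Sets"
    "HOL-Library.Multiset"
    "HOL-Library.Poly_Mapping"
    "HOL-Algebra.Module"
    "HOL-Algebra.QuotRing"
    "HOL-Algebra.Algebraic_Closure_Type"
begin

section \<open>Algebras over the rationals\<close>

abbreviation rat_field :: "rat ring" where
  "rat_field \<equiv> ring_of_type_algebra"

definition linear_map ::
  "('k, 'r) ring_scheme \<Rightarrow> ('k, 'a, 'c) module_scheme \<Rightarrow> ('k, 'b, 'd) module_scheme \<Rightarrow> ('a \<Rightarrow> 'b) \<Rightarrow> bool"
  where
  "linear_map K M N f \<longleftrightarrow>
     f \<in> carrier M \<rightarrow> carrier N \<and>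
     (\<forall>x\<in>carrier M. \<forall>y\<in>carrier M. f (x \<oplus>\<^bsub>M\<^esub> y) = f x \<oplus>\<^bsub>N\<^esub> f y) \<and>
     (\<forall>c\<in>carrier K. \<forall>x\<in>carrier M. f (c \<odot>\<^bsub>M\<^esub> x) = c \<odot>\<^bsub>N\<^esub> f x)"

definition algebra_iso ::
  "('k, 'r) ring_scheme \<Rightarrow> ('k, 'a, 'c) module_scheme \<Rightarrow> ('k, 'b, 'd) module_scheme \<Rightarrow> ('a \<Rightarrow> 'b) \<Rightarrow> bool"
  where
  "algebra_iso K M N f \<longleftrightarrow>
     algebra K M \<and> algebra K N \<and> linear_map K M N f \<and> f \<in> ring_iso M N"

definition basis_family :: "(rat, 'a, 'c) module_scheme \<Rightarrow> 'i set \<Rightarrow> ('i \<Rightarrow> 'a) \<Rightarrow> bool" where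
  "basis_family M I b \<longleftrightarrow>
     b \<in> I \<rightarrow> carrier M \<and>
     (\<forall>x\<in>carrier M. \<exists>!c :: 'i \<Rightarrow>\<^sub>0 rat. Poly_Mapping.keys c \<subseteq> I \<and>
        x = (\<Oplus>\<^bsub>M\<^esub>i\<in>Poly_Mapping.keys c. Poly_Mapping.lookup c i \<odot>\<^bsub>M\<^esub> b i))"


section \<open>Set partitions and the shifted arc-shuffle\<close>

definition set_partitions :: "nat \<Rightarrow> nat set set set" where
  "set_partitions n = {\<pi>. partition_on {1..n} \<pi>}"

definition all_set_partitions :: "nat set set set" where
  "all_set_partitions = (\<Union>n. set_partitions n)"

definition part_size :: "nat set set \<Rightarrow> nat" where
  "part_size \<pi> = card (\<Union>\<pi>)"

text \<open>The position of \<open>i\<close> in the ground set, counted from \<open>0\<close>, is the number of smaller elements.\<close>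

definition shift :: "nat set \<Rightarrow> nat set set \<Rightarrow> nat set set" where
  "shift S \<pi> = (\<lambda>B. (\<lambda>i. sorted_list_of_set S ! card {j \<in> \<Union>\<pi>. j < i}) ` B) ` \<pi>"

definition arc_shuffle :: "nat set set \<Rightarrow> nat set set \<Rightarrow> nat set set multiset" where
  "arc_shuffle \<tau> \<theta> =
     (let n = part_size \<tau>; m = part_size \<theta> in
      image_mset (\<lambda>S. shift S \<tau> \<union> shift ({1..n + m} - S) \<theta>)
        (mset_set {S. S \<subseteq> {1..n + m} \<and> card S = n}))"

definition Succ :: "nat set set \<Rightarrow> nat set" where
  "Succ \<pi> = {i \<in> {1..<part_size \<pi>}. \<exists>B\<in>\<pi>. i \<in> B \<and> i + 1 \<in> B}"

definition weakly_shuffle_compatible :: "(nat set set \<Rightarrow> 's) \<Rightarrow> bool" where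
  "weakly_shuffle_compatible st \<longleftrightarrow>
     (\<forall>\<tau>\<in>all_set_partitions. \<forall>\<theta>\<in>all_set_partitions.
      \<forall>\<tau>'\<in>all_set_partitions. \<forall>\<theta>'\<in>all_set_partitions.
        st \<tau> = st \<tau>' \<and> st \<theta> = st \<theta>' \<and> part_size \<tau> = part_size \<tau>' \<and> part_size \<theta> = part_size \<theta>' \<longrightarrow>
        image_mset st (arc_shuffle \<tau> \<theta>) = image_mset st (arc_shuffle \<tau>' \<theta>'))"


section \<open>The algebra of a statistic\<close>

definition st_class :: "(nat set set \<Rightarrow> 's) \<Rightarrow> nat set set \<Rightarrow> nat set set set" where
  "st_class st \<pi> = {\<tau> \<in> all_set_partitions. st \<tau> = st \<pi> \<and> part_size \<tau> = part_size \<pi>}"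

definition basis_elem :: "(nat set set \<Rightarrow> 's) \<Rightarrow> nat set set \<Rightarrow> (nat set set set \<Rightarrow>\<^sub>0 rat)" where
  "basis_elem st \<pi> = Poly_Mapping.single (st_class st \<pi>) 1"

text \<open>
  The product of two classes is computed from chosen representatives; by
  \<open>partition_algebra_mult_basis\<close> below the choice is irrelevant when the statistic is weakly
  shuffle-compatible.
\<close>

definition class_prod ::
  "(nat set set \<Rightarrow> 's) \<Rightarrow> nat set set set \<Rightarrow> nat set set set \<Rightarrow> (nat set set set \<Rightarrow>\<^sub>0 rat)" where
  "class_prod st C D = (\<Sum>\<pi>\<in>#arc_shuffle (SOME \<tau>. \<tau> \<in> C) (SOME \<theta>. \<theta> \<in> D). basis_elem st \<pi>)"

definition partition_algebra ::
  "(nat set set \<Rightarrow> 's) \<Rightarrow> (rat, nat set set set \<Rightarrow>\<^sub>0 rat) module" where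
  "partition_algebra st =
     \<lparr>carrier = {x. Poly_Mapping.keys x \<subseteq> st_class st ` all_set_partitions},
      monoid.mult = (\<lambda>x y. \<Sum>C\<in>Poly_Mapping.keys x. \<Sum>D\<in>Poly_Mapping.keys y.
        Poly_Mapping.map ((*) (Poly_Mapping.lookup x C * Poly_Mapping.lookup y D)) (class_prod st C D)),
      one = basis_elem st {},
      ring.zero = 0,
      add = (+),
      module.smult = (\<lambda>c. Poly_Mapping.map ((*) c))\<rparr>"

lemma Union_shift:
  assumes "finite (\<Union>\<pi>)" "finite S" "card S = card (\<Union>\<pi>)"
  shows "\<Union>(shift S \<pi>) = S"
proof -
  let ?A = "\<Union>\<pi>"
  let ?r = "\<lambda>i. card {j \<in> ?A. j < i}"
  have mono: "?r i < ?r i'" if "i \<in> ?A" "i' \<in> ?A" "i < i'" for i i'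
    using that assms(1) by (intro psubset_card_mono) (auto intro: less_trans)
  have "inj_on ?r ?A"
  proof (rule inj_onI)
    fix i i' assume "i \<in> ?A" "i' \<in> ?A" "?r i = ?r i'"
    with mono[of i i'] mono[of i' i] show "i = i'"
      by (cases i i' rule: linorder_cases) auto
  qed
  moreover have "?r ` ?A \<subseteq> {..<card ?A}"
    using assms(1) by (auto intro!: psubset_card_mono)
  ultimately have img: "?r ` ?A = {..<card ?A}"
    by (intro card_subset_eq) (auto simp: card_image)
  have "\<Union>(shift S \<pi>) = (\<lambda>i. sorted_list_of_set S ! ?r i) ` ?A"
    unfolding shift_def by blast
  also have "\<dots> = (!) (sorted_list_of_set S) ` (?r ` ?A)"
    by (simp add: image_image)
  also have "\<dots> = (!) (sorted_list_of_set S) ` {..<length (sorted_list_of_set S)}"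
    using img assms(3) by simp
  also have "\<dots> = set (sorted_list_of_set S)"
    by (auto simp only: set_conv_nth lessThan_iff)
  also have "\<dots> = S"
    using assms(2) by simp
  finally show ?thesis .
qed

lemma part_size_arc_shuffle:
  assumes "\<tau> \<in> all_set_partitions" "\<theta> \<in> all_set_partitions" "\<pi> \<in># arc_shuffle \<tau> \<theta>"
  shows "part_size \<pi> = part_size \<tau> + part_size \<theta>"
proof -
  let ?N = "{1..part_size \<tau> + part_size \<theta>}"
  have fin: "finite (\<Union>\<tau>)" "finite (\<Union>\<theta>)"
    using assms(1,2) by (auto simp: all_set_partitions_def set_partitions_def partition_on_def)
  from assms(3) obtain S where S: "S \<subseteq> ?N" "card S = part_size \<tau>"
    and \<pi>: "\<pi> = shift S \<tau> \<union> shift (?N - S) \<theta>"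
    by (auto simp: arc_shuffle_def Let_def)
  have "finite S" using S(1) finite_subset by blast
  then have "card (?N - S) = part_size \<theta>"
    using S by (simp add: card_Diff_subset)
  then have "\<Union>\<pi> = S \<union> (?N - S)"
    using S(2) fin \<open>finite S\<close> by (simp add: \<pi> Union_shift part_size_def)
  then show ?thesis using S(1) by (simp add: part_size_def[of \<pi>] Un_absorb1)
qed

lemma partition_algebra_mult_basis:
  assumes wsc: "weakly_shuffle_compatible st"
    and \<tau>: "\<tau> \<in> all_set_partitions" and \<theta>: "\<theta> \<in> all_set_partitions"
  shows "basis_elem st \<tau> \<otimes>\<^bsub>partition_algebra st\<^esub> basis_elem st \<theta> =
    (\<Sum>\<pi>\<in>#arc_shuffle \<tau> \<theta>. basis_elem st \<pi>)"
proof -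
  define \<tau>' \<theta>' where "\<tau>' = (SOME x. x \<in> st_class st \<tau>)" and "\<theta>' = (SOME x. x \<in> st_class st \<theta>)"
  have "\<tau> \<in> st_class st \<tau>" "\<theta> \<in> st_class st \<theta>"
    using \<tau> \<theta> by (auto simp: st_class_def)
  then have "\<tau>' \<in> st_class st \<tau>" "\<theta>' \<in> st_class st \<theta>"
    unfolding \<tau>'_def \<theta>'_def by (metis someI_ex)+
  then have eq: "\<tau>' \<in> all_set_partitions" "\<theta>' \<in> all_set_partitions"
    "st \<tau>' = st \<tau>" "st \<theta>' = st \<theta>" "part_size \<tau>' = part_size \<tau>" "part_size \<theta>' = part_size \<theta>"
    by (auto simp: st_class_def)
  let ?n = "part_size \<tau> + part_size \<theta>"
  let ?f = "\<lambda>s. Poly_Mapping.single {\<rho> \<in> all_set_partitions. st \<rho> = s \<and> part_size \<rho> = ?n} (1::rat)"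
  have *: "image_mset (basis_elem st) (arc_shuffle \<alpha> \<beta>) = image_mset ?f (image_mset st (arc_shuffle \<alpha> \<beta>))"
    if "\<alpha> \<in> all_set_partitions" "\<beta> \<in> all_set_partitions" "part_size \<alpha> = part_size \<tau>" "part_size \<beta> = part_size \<theta>"
    for \<alpha> \<beta>
    unfolding multiset.map_comp
    by (rule image_mset_cong) (use that in \<open>simp add: basis_elem_def st_class_def part_size_arc_shuffle\<close>)
  have "image_mset st (arc_shuffle \<tau>' \<theta>') = image_mset st (arc_shuffle \<tau> \<theta>)"
    using wsc eq \<tau> \<theta> unfolding weakly_shuffle_compatible_def by blast
  then have "image_mset (basis_elem st) (arc_shuffle \<tau>' \<theta>') = image_mset (basis_elem st) (arc_shuffle \<tau> \<theta>)"
    using *[OF eq(1,2,5,6)] *[OF \<tau> \<theta> refl refl] by simp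
  then have "class_prod st (st_class st \<tau>) (st_class st \<theta>) = (\<Sum>\<pi>\<in>#arc_shuffle \<tau> \<theta>. basis_elem st \<pi>)"
    by (simp add: class_prod_def \<tau>'_def \<theta>'_def)
  moreover have "Poly_Mapping.map ((*) (1::rat)) x = x" for x :: "nat set set set \<Rightarrow>\<^sub>0 rat"
    by (rule poly_mapping_eqI) (simp add: Poly_Mapping.map.rep_eq when_def)
  ultimately show ?thesis
    by (simp add: partition_algebra_def basis_elem_def)
qed


section \<open>Quasisymmetric functions\<close>

text \<open>
  A formal power series in the variables \<open>x\<^sub>0, x\<^sub>1, x\<^sub>2, \<dots>\<close> is given by its coefficients; a monomial is its
  finitely supported exponent function.
\<close>

type_synonym series = "(nat \<Rightarrow>\<^sub>0 nat) \<Rightarrow> rat"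

definition composition :: "nat list \<Rightarrow> bool" where
  "composition \<alpha> \<longleftrightarrow> (\<forall>a\<in>set \<alpha>. a > 0)"

definition monomial :: "nat list \<Rightarrow> nat list \<Rightarrow> (nat \<Rightarrow>\<^sub>0 nat)" where
  "monomial is \<alpha> = (\<Sum>(i, a)\<leftarrow>zip is \<alpha>. Poly_Mapping.single i a)"

definition monomial_degree :: "(nat \<Rightarrow>\<^sub>0 nat) \<Rightarrow> nat" where
  "monomial_degree m = (\<Sum>i\<in>Poly_Mapping.keys m. Poly_Mapping.lookup m i)"

definition quasisymmetric :: "series \<Rightarrow> bool" where
  "quasisymmetric f \<longleftrightarrow>
     (\<exists>d. \<forall>m. f m \<noteq> 0 \<longrightarrow> monomial_degree m \<le> d) \<and>
     (\<forall>\<alpha> is js. composition \<alpha> \<and> length is = length \<alpha> \<and> length js = length \<alpha> \<and>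
        sorted_wrt (<) is \<and> sorted_wrt (<) js \<longrightarrow> f (monomial is \<alpha>) = f (monomial js \<alpha>))"

definition QSym :: "(rat, series) module" where
  "QSym =
     \<lparr>carrier = {f. quasisymmetric f},
      monoid.mult = (\<lambda>f g m. \<Sum>(a, b) | a + b = m. f a * g b),
      one = (\<lambda>m. if m = 0 then 1 else 0),
      ring.zero = (\<lambda>m. 0),
      add = (\<lambda>f g m. f m + g m),
      module.smult = (\<lambda>c f m. c * f m)\<rparr>"


section \<open>Compositions, tie words and tie bases\<close>

text \<open>For \<open>n = 0\<close> the formula for the parts would give \<open>(0)\<close> in place of the empty composition.\<close>

definition Comp :: "nat \<Rightarrow> nat set \<Rightarrow> nat list" where
  "Comp n S = (if n = 0 then []
     else let s = sorted_list_of_set S in map2 (-) (s @ [n]) (0 # s))"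

definition Comp_set :: "nat list \<Rightarrow> nat set" where
  "Comp_set \<alpha> = the_inv_into (Pow {1..<sum_list \<alpha>}) (Comp (sum_list \<alpha>)) \<alpha>"

definition Tie :: "nat list \<Rightarrow> nat set" where
  "Tie v = {i \<in> {1..<length v}. v ! (i - 1) = v ! i}"

text \<open>\<open>tie_letter S i\<close> is the letter \<open>w\<^bsub>i+1\<^esub>\<close>, since lists are indexed from \<open>0\<close>.\<close>

primrec tie_letter :: "nat set \<Rightarrow> nat \<Rightarrow> nat" where
  "tie_letter S 0 = 1"
| "tie_letter S (Suc i) = (if Suc i \<in> S then tie_letter S i else tie_letter S i + 1)"

definition tie_word :: "nat list \<Rightarrow> nat list" where
  "tie_word \<alpha> = map (tie_letter (Comp_set \<alpha>)) [0..<sum_list \<alpha>]"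

text \<open>The largest letter of the empty word is read as \<open>0\<close>.\<close>

definition max_letter :: "nat list \<Rightarrow> nat" where
  "max_letter w = Max (insert 0 (set w))"

text \<open>
  The two words have no letter in common, so distinct interleavings are distinct words and
  a sum over the set \<^const>\<open>shuffles\<close> counts each interleaving once.
\<close>

definition tie_basis :: "(nat list \<Rightarrow> series) \<Rightarrow> bool" where
  "tie_basis T \<longleftrightarrow>
     basis_family QSym {\<alpha>. composition \<alpha>} T \<and>
     (\<forall>\<alpha> \<beta>. composition \<alpha> \<and> composition \<beta> \<longrightarrow>
        T \<alpha> \<otimes>\<^bsub>QSym\<^esub> T \<beta> =
          (\<Oplus>\<^bsub>QSym\<^esub>v\<in>shuffles (tie_word \<alpha>) (map ((+) (max_letter (tie_word \<alpha>))) (tie_word \<beta>)).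
             T (Comp (length v) (Tie v))))"

end

theory Submission
  imports Defs
begin

text \<open>
  Placing \<open>\<tau>\<close> on \<open>S\<close> and \<open>\<theta>\<close> on the complement creates no succession across the two parts, and
  \<open>i, i + 1 \<in> S\<close> share a block iff the corresponding consecutive elements of \<open>\<tau>\<close> do. Hence the
  succession set of a shifted arc-shuffle depends only on \<open>S\<close> and on the two succession sets, which is
  shuffle-compatibility. The tie set of the interleaving of two disjoint words with positions \<open>S\<close> obeys
  the same formula, so the structure constants agree with those of a tie basis.
  Every subset of \<open>{1..<n}\<close> is a succession set, so classes correspond to compositions and
  the linear map is a bijection between bases. The ring axioms are checked for power series and pulled
  back along the bijection; closure of \<open>QSym\<close> under products comes for free from the tie basis.
\<close>

section \<open>Compositions and subsets\<close>

text \<open>Used to invert \<open>Comp\<close>. The start value \<open>a\<close> is an accumulator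
  for the inductions and is not itself listed, so from 0 a nonempty composition of n yields its
  boundaries, ending in n.\<close>

primrec partial_sums :: "nat \<Rightarrow> nat list \<Rightarrow> nat list" where
  "partial_sums a [] = []"
| "partial_sums a (x # xs) = (a + x) # partial_sums (a + x) xs"

text \<open>\<open>map2\<close> drops the surplus last entry of \<open>a # L\<close>, so each entry
  of L is paired with its predecessor. Strict increase keeps the subtraction on naturals from being
  cut off at 0.\<close>

lemma partial_sums_diffs:
  "sorted_wrt (<) (a # L) \<Longrightarrow> partial_sums a (map2 (-) L (a # L)) = L"
  by (induction L arbitrary: a) auto

lemma diffs_partial_sums: "map2 (-) (partial_sums a \<alpha>) (a # partial_sums a \<alpha>) = \<alpha>"
  by (induction \<alpha> arbitrary: a) auto

lemma partial_sums_greater: "composition \<alpha> \<Longrightarrow> x \<in> set (partial_sums a \<alpha>) \<Longrightarrow> a < x"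
  by (induction \<alpha> arbitrary: a) (force simp: composition_def)+

lemma sorted_partial_sums: "composition \<alpha> \<Longrightarrow> sorted_wrt (<) (a # partial_sums a \<alpha>)"
proof (induction \<alpha> arbitrary: a)
  case (Cons x \<alpha>)
  then have "composition \<alpha>" by (simp add: composition_def)
  then show ?case using Cons.IH[of "a + x"] Cons.prems by (force simp: composition_def)
qed simp

lemma last_partial_sums: "\<alpha> \<noteq> [] \<Longrightarrow> last (partial_sums a \<alpha>) = a + sum_list \<alpha>"
proof (induction \<alpha> arbitrary: a)
  case (Cons x \<alpha>)
  then show ?case by (cases \<alpha>) auto
qed simp

lemma partial_sums_eq_Nil: "partial_sums a \<alpha> = [] \<longleftrightarrow> \<alpha> = []"
  by (cases \<alpha>) auto

lemma composition_diffs: "sorted_wrt (<) (a # L) \<Longrightarrow> composition (map2 (-) L (a # L))"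
proof (induction L arbitrary: a)
  case (Cons x L)
  then show ?case using Cons.IH[of x] by (simp add: composition_def)
qed (simp add: composition_def)

lemma sum_list_diffs:
  "sorted_wrt (<) (a # L) \<Longrightarrow> (a::nat) + sum_list (map2 (-) L (a # L)) = last (a # L)"
proof (induction L arbitrary: a)
  case (Cons x L)
  then have "x + sum_list (map2 (-) L (x # L)) = last (x # L)" "a < x" by auto
  then have "a + (x - a + sum_list (map2 (-) L (x # L))) = last (x # L)" by linarith
  then show ?case by simp
qed simp

text \<open>The extra n at the end of the second list is cut off by \<open>zip\<close>. With it,
  both lists have the shape \<open>L\<close> and \<open>0 # L\<close>, which the results on partial
  sums require.\<close>

lemma Comp_eq_diffs:
  assumes "n > 0"
  shows "Comp n S = map2 (-) (sorted_list_of_set S @ [n]) (0 # sorted_list_of_set S @ [n])"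
proof -
  have "zip (s @ [n]) (0 # s @ [n]) = zip (s @ [n]) (0 # s)" for s
    using zip_append1[of "0 # s" "[n]" "s @ [n]"] zip_append2[of "s @ [n]" "0 # s" "[n]"] by simp
  then show ?thesis using assms by (simp add: Comp_def Let_def)
qed

lemma sorted_boundaries:
  assumes "(n::nat) > 0" "S \<subseteq> {1..<n}"
  shows "sorted_wrt (<) (0 # sorted_list_of_set S @ [n])"
proof -
  have "finite S" using assms(2) by (rule finite_subset) simp
  then show ?thesis
    using assms by (auto simp: sorted_wrt_append)
qed

lemma bij_betw_Comp:
  "bij_betw (Comp n) (Pow {1..<n}) {\<alpha>. composition \<alpha> \<and> sum_list \<alpha> = n}"
proof (cases "n = 0")
  case True
  \<comment> \<open>Here both sides are singletons: the only subset is empty, and the only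
    composition of 0 is the empty one.\<close>
  have "\<alpha> = []" if "composition \<alpha>" "sum_list \<alpha> = 0" for \<alpha>
    using that by (cases \<alpha>) (auto simp: composition_def)
  then have "{\<alpha>. composition \<alpha> \<and> sum_list \<alpha> = n} = {[]}"
    using True by (auto simp: composition_def)
  then show ?thesis using True by (simp add: bij_betw_def Comp_def)
next
  case False
  \<comment> \<open>The last partial sum is always n, so removing it leaves the inner boundaries,
    which form the subset.\<close>
  let ?inv = "\<lambda>\<alpha>. set (butlast (partial_sums 0 \<alpha>))"
  show ?thesis
  proof (rule bij_betw_byWitness[where f' = ?inv])
    show "\<forall>S\<in>Pow {1..<n}. ?inv (Comp n S) = S"
    proof
      fix S assume S: "S \<in> Pow {1..<n}"
      then have "finite S" using finite_subset by blast
      then show "?inv (Comp n S) = S"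
        using partial_sums_diffs[OF sorted_boundaries] False S by (simp add: Comp_eq_diffs del: zip_Cons_Cons)
    qed
    have *: "sorted_wrt (<) (butlast (partial_sums 0 \<alpha>) @ [n])"
      "butlast (partial_sums 0 \<alpha>) @ [n] = partial_sums 0 \<alpha>" "0 \<notin> ?inv \<alpha>"
      if "composition \<alpha>" "sum_list \<alpha> = n" for \<alpha>
    proof -
      have ne: "partial_sums 0 \<alpha> \<noteq> []" using that False by (auto simp: partial_sums_eq_Nil)
      have "last (partial_sums 0 \<alpha>) = n"
        using that ne by (simp add: last_partial_sums partial_sums_eq_Nil)
      then show *: "butlast (partial_sums 0 \<alpha>) @ [n] = partial_sums 0 \<alpha>"
        using ne append_butlast_last_id by force
      show "sorted_wrt (<) (butlast (partial_sums 0 \<alpha>) @ [n])"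
        using sorted_partial_sums[OF that(1), of 0] * by simp
      show "0 \<notin> ?inv \<alpha>"
        using partial_sums_greater[OF that(1), of 0 0] by (auto dest: in_set_butlastD)
    qed
    show "\<forall>\<alpha>\<in>{\<alpha>. composition \<alpha> \<and> sum_list \<alpha> = n}. Comp n (?inv \<alpha>) = \<alpha>"
    proof
      fix \<alpha> assume "\<alpha> \<in> {\<alpha>. composition \<alpha> \<and> sum_list \<alpha> = n}"
      then have \<alpha>: "composition \<alpha>" "sum_list \<alpha> = n" by auto
      have "sorted_list_of_set (?inv \<alpha>) = butlast (partial_sums 0 \<alpha>)"
        using *(1)[OF \<alpha>] by (simp add: sorted_wrt_append strict_sorted_iff sorted_list_of_set.idem_if_sorted_distinct)
      then show "Comp n (?inv \<alpha>) = \<alpha>"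
        using False *(2)[OF \<alpha>] diffs_partial_sums[of 0 \<alpha>] by (simp add: Comp_eq_diffs del: zip_Cons_Cons)
    qed
    show "Comp n ` Pow {1..<n} \<subseteq> {\<alpha>. composition \<alpha> \<and> sum_list \<alpha> = n}"
    proof safe
      fix S assume "S \<subseteq> {1..<n}"
      then have s: "sorted_wrt (<) (0 # sorted_list_of_set S @ [n])"
        using False sorted_boundaries by blast
      show "composition (Comp n S)"
        using composition_diffs[OF s] False by (simp add: Comp_eq_diffs del: zip_Cons_Cons)
      show "sum_list (Comp n S) = n"
        using sum_list_diffs[OF s] False by (simp add: Comp_eq_diffs del: zip_Cons_Cons)
    qed
    show "?inv ` {\<alpha>. composition \<alpha> \<and> sum_list \<alpha> = n} \<subseteq> Pow {1..<n}"
    proof safe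
      fix \<alpha> x assume \<alpha>: "composition \<alpha>" "n = sum_list \<alpha>" and x: "x \<in> ?inv \<alpha>"
      have "x \<noteq> 0"
        using *(3)[OF \<alpha>(1) \<alpha>(2)[symmetric]] x by (cases "x = 0") auto
      moreover have "x < n"
        using *(1)[OF \<alpha>(1) \<alpha>(2)[symmetric]] x by (simp add: sorted_wrt_append)
      ultimately have "x \<noteq> 0" "x < n" .
      then show "x \<in> {1..<sum_list \<alpha>}" using \<alpha> by simp
    qed
  qed
qed

lemma composition_Comp: "S \<subseteq> {1..<n} \<Longrightarrow> composition (Comp n S)"
  and sum_list_Comp: "S \<subseteq> {1..<n} \<Longrightarrow> sum_list (Comp n S) = n"
  using bij_betw_apply[OF bij_betw_Comp, of S n] by auto

lemma Comp_set_Comp: "S \<subseteq> {1..<n} \<Longrightarrow> Comp_set (Comp n S) = S"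
  using bij_betw_Comp[of n]
  by (simp add: Comp_set_def sum_list_Comp bij_betw_def the_inv_into_f_f)

lemma Comp_set_subset: "composition \<alpha> \<Longrightarrow> Comp_set \<alpha> \<subseteq> {1..<sum_list \<alpha>}"
  and Comp_Comp_set: "composition \<alpha> \<Longrightarrow> Comp (sum_list \<alpha>) (Comp_set \<alpha>) = \<alpha>"
proof -
  assume "composition \<alpha>"
  then obtain S where S: "S \<subseteq> {1..<sum_list \<alpha>}" "\<alpha> = Comp (sum_list \<alpha>) S"
    using bij_betw_Comp[of "sum_list \<alpha>"] unfolding bij_betw_def by blast
  then have "Comp_set \<alpha> = S" using Comp_set_Comp by metis
  then show "Comp_set \<alpha> \<subseteq> {1..<sum_list \<alpha>}" "Comp (sum_list \<alpha>) (Comp_set \<alpha>) = \<alpha>"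
    using S by auto
qed

section \<open>Tie words\<close>

lemma length_tie_word [simp]: "length (tie_word \<alpha>) = sum_list \<alpha>"
  by (simp add: tie_word_def)

lemma Tie_tie_word: "composition \<alpha> \<Longrightarrow> Tie (tie_word \<alpha>) = Comp_set \<alpha>"
proof -
  assume "composition \<alpha>"
  \<comment> \<open>With 0-based lists, \<open>tie_letter S (i - 1)\<close> is the letter at
    position i; the recursion repeats it at position i + 1 exactly when i lies in S.\<close>
  have *: "tie_letter S (i - 1) = tie_letter S i \<longleftrightarrow> i \<in> S" if "i > 0" for S i
    using that by (cases i) auto
  have "i \<in> Tie (tie_word \<alpha>) \<longleftrightarrow> i \<in> {1..<sum_list \<alpha>} \<and> i \<in> Comp_set \<alpha>" for i
    using *[of i "Comp_set \<alpha>"] by (auto simp: Tie_def tie_word_def)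
  then show ?thesis
    using Comp_set_subset[OF \<open>composition \<alpha>\<close>] by blast
qed

text \<open>Ties only test letters for equality. This covers adding the largest letter of the first
  word to the second.\<close>

lemma Tie_map_inj: "inj_on f (set w) \<Longrightarrow> Tie (map f w) = Tie w"
  unfolding Tie_def by (auto simp: inj_on_eq_iff)

lemma tie_letter_pos: "tie_letter S i > 0"
  by (induction i) auto

text \<open>Letters of tie words are positive, so every shifted letter exceeds the largest letter of
  the first word.\<close>

lemma disjoint_tie_words:
  "set (tie_word \<alpha>) \<inter> set (map ((+) (max_letter (tie_word \<alpha>))) (tie_word \<beta>)) = {}"
proof -
  have "x \<le> max_letter w" if "x \<in> set w" for x w
    using that by (simp add: max_letter_def)
  moreover have "y > 0" if "y \<in> set (tie_word \<beta>)" for y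
    using that tie_letter_pos by (auto simp: tie_word_def)
  ultimately show ?thesis by fastforce
qed

section \<open>Ties of interleavings\<close>

text \<open>For k in S this is the 0-based index of k in the sorted list of S. Partitions and tie
  sets count from 1, whence the many \<open>Suc (rank S k)\<close> below.\<close>

definition rank :: "nat set \<Rightarrow> nat \<Rightarrow> nat" where
  "rank S k = card {j \<in> S. j < k}"

text \<open>The elements of S below its entry at index p are exactly the p earlier entries, and
  these are distinct.\<close>

lemma rank_nth_sorted_list_of_set:
  assumes "p < card S"
  shows "rank S (sorted_list_of_set S ! p) = p"
proof -
  let ?L = "sorted_list_of_set S"
  have fin: "finite S" using assms by (metis card.infinite not_less_zero)
  have mono: "?L ! i < ?L ! j \<longleftrightarrow> i < j" if "i < card S" "j < card S" for i j
    using that sorted_wrt_nth_less[of "(<)" ?L] strict_sorted_list_of_set[of S]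
    by (metis length_sorted_list_of_set linorder_neqE_nat order_less_asym order_less_irrefl)
  have S: "k \<in> S \<longleftrightarrow> (\<exists>i<card S. k = ?L ! i)" for k
    using fin by (metis in_set_conv_nth length_sorted_list_of_set set_sorted_list_of_set)
  have "k \<in> {j \<in> S. j < ?L ! p} \<longleftrightarrow> k \<in> (!) ?L ` {..<p}" for k
  proof -
    have "k \<in> {j \<in> S. j < ?L ! p} \<longleftrightarrow> (\<exists>i<card S. k = ?L ! i \<and> ?L ! i < ?L ! p)"
      using S[of k] by auto
    also have "\<dots> \<longleftrightarrow> (\<exists>i<p. k = ?L ! i)"
      using mono assms less_trans by metis
    finally show ?thesis by auto
  qed
  then have "{j \<in> S. j < ?L ! p} = (!) ?L ` {..<p}" by blast
  moreover have "inj_on ((!) ?L) {..<p}"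
    using assms by (intro inj_on_nth) auto
  ultimately show ?thesis by (simp add: rank_def card_image)
qed

lemma rank_less: "finite S \<Longrightarrow> k \<in> S \<Longrightarrow> rank S k < card S"
  unfolding rank_def by (intro psubset_card_mono) auto

lemma nth_sorted_list_of_set_rank:
  assumes "finite S" "k \<in> S"
  shows "sorted_list_of_set S ! rank S k = k"
proof -
  obtain p where "p < card S" "sorted_list_of_set S ! p = k"
    using assms by (metis in_set_conv_nth length_sorted_list_of_set set_sorted_list_of_set)
  then show ?thesis using rank_nth_sorted_list_of_set by metis
qed

lemma rank_Suc:
  assumes "finite S" "k \<in> S"
  shows "rank S (Suc k) = Suc (rank S k)"
proof -
  have "{j \<in> S. j < Suc k} = insert k {j \<in> S. j < k}"
    using assms by auto
  then show ?thesis using assms by (simp add: rank_def)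
qed

text \<open>The part of a shuffled succession or tie set that comes from one factor, placed at \<open>S\<close>.\<close>

definition spread :: "nat set \<Rightarrow> nat set \<Rightarrow> nat set" where
  "spread S A = {i \<in> S. Suc i \<in> S \<and> Suc (rank S i) \<in> A}"

text \<open>An interleaving encoded by the 1-based positions S of the letters of \<open>xs\<close>.
  Shifted arc-shuffles are indexed by the same sets S, which makes the two kinds of shuffle
  comparable.\<close>

definition place :: "'a list \<Rightarrow> 'a list \<Rightarrow> nat set \<Rightarrow> 'a list" where
  "place xs ys S = map (\<lambda>i. if i \<in> S then xs ! rank S i
     else ys ! rank ({1..length xs + length ys} - S) i) [1..<Suc (length xs + length ys)]"

lemma length_place [simp]: "length (place xs ys S) = length xs + length ys"
  by (simp add: place_def del: upt_Suc)

lemma nth_place: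
  assumes "i \<in> {1..length xs + length ys}"
  shows "place xs ys S ! (i - 1) = (if i \<in> S then xs ! rank S i
     else ys ! rank ({1..length xs + length ys} - S) i)"
  using assms by (cases i) (auto simp: place_def simp del: upt_Suc)

lemma map_rank_sorted_list_of_set:
  assumes "card S = length xs"
  shows "map (\<lambda>i. xs ! rank S i) (sorted_list_of_set S) = xs"
  by (rule nth_equalityI) (use assms in \<open>auto simp: rank_nth_sorted_list_of_set\<close>)

lemma filter_mem_upt:
  assumes "S \<subseteq> {a..<b}"
  shows "filter (\<lambda>i. i \<in> S) [a..<b] = sorted_list_of_set S"
proof -
  have "set (filter (\<lambda>i. i \<in> S) [a..<b]) = S" using assms by auto
  moreover have "sorted_list_of_set (set (filter (\<lambda>i. i \<in> S) [a..<b])) = filter (\<lambda>i. i \<in> S) [a..<b]"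
    by (intro sorted_list_of_set.idem_if_sorted_distinct sorted_wrt_filter sorted_upt distinct_filter distinct_upt)
  ultimately show ?thesis by simp
qed

text \<open>Since the alphabets are disjoint, S is recovered as the set of positions carrying
  letters of \<open>xs\<close>, which gives injectivity. Filtering by the two alphabets returns the
  two words, so the result is an interleaving.\<close>

lemma bij_betw_place:
  assumes disj: "set xs \<inter> set ys = {}"
  shows "bij_betw (place xs ys)
    {S. S \<subseteq> {1..length xs + length ys} \<and> card S = length xs} (shuffles xs ys)"
proof -
  let ?N = "{1..length xs + length ys}"
  let ?\<S> = "{S. S \<subseteq> ?N \<and> card S = length xs}"
  let ?P = "\<lambda>x. x \<in> set xs"
  have letter: "place xs ys S ! (i - 1) \<in> set xs \<longleftrightarrow> i \<in> S"
    if "S \<in> ?\<S>" "i \<in> ?N" for S i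
  proof -
    have "finite S" using that(1) finite_subset by blast
    then have "card (?N - S) = length ys" using that(1) by (simp add: card_Diff_subset)
    then have xs: "i \<in> S \<Longrightarrow> xs ! rank S i \<in> set xs"
      and ys: "i \<notin> S \<Longrightarrow> ys ! rank (?N - S) i \<in> set ys"
      using that \<open>finite S\<close> rank_less[of S i] rank_less[of "?N - S" i] by simp_all
    then show ?thesis
      unfolding nth_place[OF that(2)] using disj by (cases "i \<in> S") auto
  qed
  have "inj_on (place xs ys) ?\<S>"
  proof (rule inj_onI)
    fix S S' assume "S \<in> ?\<S>" "S' \<in> ?\<S>" "place xs ys S = place xs ys S'"
    then have "i \<in> S \<longleftrightarrow> i \<in> S'" if "i \<in> ?N" for i
      using that letter[of S i] letter[of S' i] by metis
    then show "S = S'" using \<open>S \<in> ?\<S>\<close> \<open>S' \<in> ?\<S>\<close> by blast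
  qed
  moreover have "place xs ys S \<in> shuffles xs ys" if S: "S \<in> ?\<S>" for S
  proof -
    have fin: "finite S" using S finite_subset by blast
    then have card: "card (?N - S) = length ys" using S by (simp add: card_Diff_subset)
    let ?f = "\<lambda>i. if i \<in> S then xs ! rank S i else ys ! rank (?N - S) i"
    let ?u = "[1..<Suc (length xs + length ys)]"
    have P: "?P (?f i) \<longleftrightarrow> i \<in> S" if "i \<in> set ?u" for i
    proof -
      from that have i: "i \<in> ?N" by auto
      show ?thesis
        using letter[OF S i] unfolding nth_place[OF i] .
    qed
    have "filter ?P (place xs ys S) = map ?f (filter (\<lambda>i. i \<in> S) ?u)"
      using P unfolding place_def filter_map comp_def
      by (intro arg_cong[where f = "map ?f"] filter_cong) auto
    also have "filter (\<lambda>i. i \<in> S) ?u = sorted_list_of_set S"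
      using S by (intro filter_mem_upt) auto
    also have "map ?f (sorted_list_of_set S) = map (\<lambda>i. xs ! rank S i) (sorted_list_of_set S)"
      using fin by simp
    also have "\<dots> = xs" using S by (intro map_rank_sorted_list_of_set) auto
    finally have xs: "filter ?P (place xs ys S) = xs" .
    have "filter (Not \<circ> ?P) (place xs ys S) = map ?f (filter (\<lambda>i. i \<in> ?N - S) ?u)"
      using P unfolding place_def filter_map comp_def
      by (intro arg_cong[where f = "map ?f"] filter_cong) auto
    also have "filter (\<lambda>i. i \<in> ?N - S) ?u = sorted_list_of_set (?N - S)"
      by (intro filter_mem_upt) auto
    also have "map ?f (sorted_list_of_set (?N - S)) =
        map (\<lambda>i. ys ! rank (?N - S) i) (sorted_list_of_set (?N - S))"
      using fin by simp
    also have "\<dots> = ys" using card by (intro map_rank_sorted_list_of_set) auto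
    finally have "List.partition ?P (place xs ys S) = (xs, ys)" using xs by (simp add: comp_def)
    \<comment> \<open>For disjoint alphabets the interleavings are exactly the words that split by
      \<open>?P\<close> into \<open>xs\<close> and \<open>ys\<close>.\<close>
    moreover have "List.partition ?P -` {(xs, ys)} = shuffles xs ys"
      using disj by (intro inv_image_partition) auto
    ultimately show ?thesis by blast
  qed
  \<comment> \<open>Surjectivity comes from counting: both finite sets have the same binomial
    cardinality.\<close>
  moreover have "card ?\<S> = card (shuffles xs ys)"
    using disj by (simp add: n_subsets card_disjoint_shuffles)
  ultimately show ?thesis
    unfolding bij_betw_def by (metis (no_types, lifting) card_image card_subset_eq finite_shuffles image_subsetI)
qed

text \<open>Neighbours i and i + 1 on different sides carry letters from disjoint alphabets and
  never tie. On the same side their ranks are consecutive, so they tie exactly when the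
  corresponding letters of that word do.\<close>

lemma Tie_place:
  assumes disj: "set xs \<inter> set ys = {}"
    and S: "S \<subseteq> {1..length xs + length ys}" "card S = length xs"
  shows "Tie (place xs ys S) =
    spread S (Tie xs) \<union> spread ({1..length xs + length ys} - S) (Tie ys)"
proof -
  let ?N = "{1..length xs + length ys}"
  let ?T = "?N - S"
  have fin: "finite S" "finite ?T" using S finite_subset by blast+
  have card: "card ?T = length ys" using S fin by (simp add: card_Diff_subset)
  have xs: "xs ! rank S i \<in> set xs" if "i \<in> S" for i
    using rank_less[OF fin(1) that] S by simp
  have ys: "ys ! rank ?T i \<in> set ys" if "i \<in> ?T" for i
    using rank_less[OF fin(2) that] card by simp
  have tx: "Suc (rank S i) \<in> Tie xs \<longleftrightarrow> xs ! rank S i = xs ! rank S (Suc i)"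
    if "i \<in> S" "Suc i \<in> S" for i
    using rank_less[OF fin(1) that(2)] rank_Suc[OF fin(1) that(1)] S by (auto simp: Tie_def)
  have ty: "Suc (rank ?T i) \<in> Tie ys \<longleftrightarrow> ys ! rank ?T i = ys ! rank ?T (Suc i)"
    if "i \<in> ?T" "Suc i \<in> ?T" for i
    using rank_less[OF fin(2) that(2)] rank_Suc[OF fin(2) that(1)] card by (auto simp: Tie_def)
  have eq: "i \<in> Tie (place xs ys S) \<longleftrightarrow>
      i \<in> ?N \<and> Suc i \<in> ?N \<and> (if i \<in> S then xs ! rank S i else ys ! rank ?T i) =
        (if Suc i \<in> S then xs ! rank S (Suc i) else ys ! rank ?T (Suc i))" for i
  proof -
    have "i \<in> Tie (place xs ys S) \<longleftrightarrow>
        i \<in> ?N \<and> Suc i \<in> ?N \<and> place xs ys S ! (i - 1) = place xs ys S ! (Suc i - 1)"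
      by (auto simp: Tie_def)
    then show ?thesis using nth_place[of i xs ys S] nth_place[of "Suc i" xs ys S] by metis
  qed
  show ?thesis
  proof (rule Set.set_eqI)
    fix i
    consider "i \<in> S" "Suc i \<in> S" | "i \<in> ?T" "Suc i \<in> ?T" | "i \<in> S" "Suc i \<in> ?T"
      | "i \<in> ?T" "Suc i \<in> S" | "i \<notin> ?N \<or> Suc i \<notin> ?N" by blast
    then show "i \<in> Tie (place xs ys S) \<longleftrightarrow> i \<in> spread S (Tie xs) \<union> spread ?T (Tie ys)"
    proof cases
      case 1
      then have "i \<in> ?N" "Suc i \<in> ?N" using S by blast+
      then show ?thesis unfolding eq using 1 by (simp add: spread_def tx del: One_nat_def)
    next
      case 2
      then have "i \<in> ?N" "Suc i \<in> ?N" "i \<notin> S" "Suc i \<notin> S" by blast+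
      then show ?thesis unfolding eq using 2 by (simp add: spread_def ty del: One_nat_def)
    next
      case 3
      then have "i \<in> ?N" "Suc i \<in> ?N" "i \<in> S" "Suc i \<notin> S" using S by blast+
      moreover have "xs ! rank S i \<noteq> ys ! rank ?T (Suc i)" using xs[OF 3(1)] ys[OF 3(2)] disj by auto
      ultimately show ?thesis unfolding eq by (simp add: spread_def)
    next
      case 4
      then have "i \<in> ?N" "Suc i \<in> ?N" "i \<notin> S" "Suc i \<in> S" using S by blast+
      moreover have "ys ! rank ?T i \<noteq> xs ! rank S (Suc i)" using ys[OF 4(1)] xs[OF 4(2)] disj by auto
      ultimately show ?thesis unfolding eq by (simp add: spread_def)
    next
      case 5
      then show ?thesis unfolding eq spread_def using S by blast
    qed
  qed
qed

section \<open>Successions of shifted arc-shuffles\<close>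

lemma set_partitions_simps:
  assumes "\<pi> \<in> set_partitions n"
  shows "\<Union>\<pi> = {1..n}" "part_size \<pi> = n" "partition_on {1..n} \<pi>"
  using assms by (auto simp: set_partitions_def partition_on_def part_size_def)

text \<open>On the ground set \<open>{1..n}\<close> exactly i - 1 elements are smaller than i, so
  the counting in \<open>shift\<close> becomes a plain index.\<close>

lemma shift_eq:
  assumes "\<pi> \<in> set_partitions n"
  shows "shift S \<pi> = (`) (\<lambda>i. sorted_list_of_set S ! (i - 1)) ` \<pi>"
proof -
  have "card {j \<in> {1..n}. j < i} = i - 1" if "i \<in> {1..n}" for i
  proof -
    have "{j \<in> {1..n}. j < i} = {1..<i}" using that by auto
    then show ?thesis by simp
  qed
  moreover have "i \<in> {1..n}" if "i \<in> B" "B \<in> \<pi>" for i B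
    using that set_partitions_simps(1)[OF assms] by blast
  ultimately show ?thesis
    unfolding shift_def set_partitions_simps(1)[OF assms]
    by (intro image_cong refl) simp
qed

lemma partition_on_shift:
  assumes "\<pi> \<in> set_partitions n" "finite S" "card S = n"
  shows "partition_on S (shift S \<pi>)"
proof -
  let ?f = "\<lambda>i. sorted_list_of_set S ! (i - 1)"
  have inj: "inj_on ?f {1..n}"
    \<comment> \<open>The inverse of the relabelling is \<open>Suc\<close> of the rank in S.\<close>
    by (rule inj_on_inverseI[where g = "\<lambda>k. Suc (rank S k)"])
      (use assms in \<open>auto simp: rank_nth_sorted_list_of_set\<close>)
  have p: "partition_on {1..n} \<pi>" "\<Union>\<pi> = {1..n}" using set_partitions_simps[OF assms(1)] by auto
  have "\<Union>(shift S \<pi>) = S"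
    using assms p by (intro Union_shift) auto
  then have "?f ` {1..n} = S"
    using p(2) unfolding shift_eq[OF assms(1)] by blast
  moreover have "{} \<notin> (`) ?f ` \<pi>"
    using p(1) by (auto simp: partition_on_def)
  ultimately show ?thesis
    using partition_on_inj_image[OF p(1) inj] by (simp add: shift_eq[OF assms(1)])
qed

text \<open>Membership in a relabelled block is pulled back along the inverse relabelling,
  \<open>Suc\<close> of the rank in S.\<close>

lemma same_block_shift:
  assumes "\<pi> \<in> set_partitions n" "finite S" "card S = n" "k \<in> S" "l \<in> S"
  shows "(\<exists>B\<in>shift S \<pi>. k \<in> B \<and> l \<in> B) \<longleftrightarrow>
    (\<exists>B\<in>\<pi>. Suc (rank S k) \<in> B \<and> Suc (rank S l) \<in> B)"
proof -
  let ?f = "\<lambda>i. sorted_list_of_set S ! (i - 1)"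
  have "k \<in> ?f ` B \<longleftrightarrow> Suc (rank S k) \<in> B" if "B \<in> \<pi>" "k \<in> S" for B k
  proof
    assume "k \<in> ?f ` B"
    then obtain i where i: "i \<in> B" "k = ?f i" by blast
    then have "i \<in> {1..n}" using that set_partitions_simps(1)[OF assms(1)] by blast
    then have "i - 1 < card S" using assms by auto
    then have "rank S k = i - 1" using i rank_nth_sorted_list_of_set by blast
    then show "Suc (rank S k) \<in> B" using i \<open>i \<in> {1..n}\<close> by simp
  next
    assume "Suc (rank S k) \<in> B"
    moreover have "?f (Suc (rank S k)) = k"
      using that assms by (simp add: nth_sorted_list_of_set_rank)
    ultimately show "k \<in> ?f ` B" by (metis image_eqI)
  qed
  then show ?thesis
    unfolding shift_eq[OF assms(1)] using assms by simp
qed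

text \<open>If i and i + 1 both lie in S, their ranks are consecutive and a shared block pulls back
  to a succession of \<pi>; otherwise neither side contains i. Writing the right side by blocks
  alone lets two shifted partitions be joined by a union.\<close>

lemma spread_Succ:
  assumes "\<pi> \<in> set_partitions n" "finite S" "card S = n"
  shows "spread S (Succ \<pi>) = {i. \<exists>B\<in>shift S \<pi>. i \<in> B \<and> Suc i \<in> B}"
proof (rule Set.set_eqI)
  fix i
  have S: "\<Union>(shift S \<pi>) = S" using partition_on_shift[OF assms] by (simp add: partition_on_def)
  show "i \<in> spread S (Succ \<pi>) \<longleftrightarrow> i \<in> {i. \<exists>B\<in>shift S \<pi>. i \<in> B \<and> Suc i \<in> B}"
  proof (cases "i \<in> S \<and> Suc i \<in> S")
    case True
    then have r: "rank S (Suc i) = Suc (rank S i)" "rank S (Suc i) < n"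
      using assms(2,3) rank_Suc[of S i] rank_less[of S "Suc i"] by simp_all
    then have "Suc (rank S i) \<in> Succ \<pi> \<longleftrightarrow> (\<exists>B\<in>\<pi>. Suc (rank S i) \<in> B \<and> Suc (rank S (Suc i)) \<in> B)"
      using set_partitions_simps(2)[OF assms(1)] by (auto simp: Succ_def)
    then show ?thesis using True same_block_shift[OF assms, of i "Suc i"] by (simp add: spread_def)
  next
    case False
    then show ?thesis using S by (auto simp: spread_def)
  qed
qed

text \<open>Each block of the union comes from one of the two partitions, so a block containing i
  and i + 1 is found on one side, and the succession set splits accordingly.\<close>

lemma shift_union_set_partitions:
  assumes "\<tau> \<in> set_partitions n" "\<theta> \<in> set_partitions m"
    and S: "S \<subseteq> {1..n + m}" "card S = n"
  shows "shift S \<tau> \<union> shift ({1..n + m} - S) \<theta> \<in> set_partitions (n + m)"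
    and "Succ (shift S \<tau> \<union> shift ({1..n + m} - S) \<theta>) =
      spread S (Succ \<tau>) \<union> spread ({1..n + m} - S) (Succ \<theta>)"
proof -
  let ?T = "{1..n + m} - S"
  have fin: "finite S" "finite ?T" using S finite_subset by blast+
  have card: "card ?T = m" using S fin by (simp add: card_Diff_subset)
  have p: "partition_on S (shift S \<tau>)" "partition_on ?T (shift ?T \<theta>)"
    using assms fin card by (auto intro: partition_on_shift)
  have "partition_on (S \<union> ?T) (shift S \<tau> \<union> shift ?T \<theta>)"
    using p unfolding partition_on_def by (auto intro: disjoint_union)
  moreover have "S \<union> ?T = {1..n + m}" using S by blast
  ultimately show *: "shift S \<tau> \<union> shift ?T \<theta> \<in> set_partitions (n + m)"
    by (simp add: set_partitions_def)
  have "i \<in> {1..<n + m}" if "B \<in> shift S \<tau> \<union> shift ?T \<theta>" "i \<in> B" "Suc i \<in> B" for i B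
  proof -
    have "i \<in> {1..n + m}" "Suc i \<in> {1..n + m}"
      using that set_partitions_simps(1)[OF *] by blast+
    then show ?thesis by simp
  qed
  then have "Succ (shift S \<tau> \<union> shift ?T \<theta>) = {i. \<exists>B\<in>shift S \<tau> \<union> shift ?T \<theta>. i \<in> B \<and> Suc i \<in> B}"
    unfolding Succ_def set_partitions_simps(2)[OF *] by auto
  then show "Succ (shift S \<tau> \<union> shift ?T \<theta>) = spread S (Succ \<tau>) \<union> spread ?T (Succ \<theta>)"
    unfolding spread_Succ[OF assms(1) fin(1) S(2)] spread_Succ[OF assms(2) fin(2) card] by blast
qed

lemma mem_all_set_partitions:
  assumes "\<pi> \<in> all_set_partitions"
  shows "\<pi> \<in> set_partitions (part_size \<pi>)"
proof -
  obtain n where "\<pi> \<in> set_partitions n" using assms by (auto simp: all_set_partitions_def)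
  then show ?thesis using set_partitions_simps(2) by simp
qed

lemma arc_shuffle_closed:
  assumes "\<tau> \<in> all_set_partitions" "\<theta> \<in> all_set_partitions" "\<pi> \<in># arc_shuffle \<tau> \<theta>"
  shows "\<pi> \<in> all_set_partitions"
proof -
  have "\<tau> \<in> set_partitions (part_size \<tau>)" "\<theta> \<in> set_partitions (part_size \<theta>)"
    using assms mem_all_set_partitions by auto
  from shift_union_set_partitions(1)[OF this] show ?thesis
    using assms(3) by (auto simp: arc_shuffle_def Let_def all_set_partitions_def)
qed

text \<open>The right side mentions the partitions only through their sizes and succession sets,
  which is all that weak shuffle-compatibility asks for.\<close>

lemma image_Succ_arc_shuffle:
  assumes "\<tau> \<in> all_set_partitions" "\<theta> \<in> all_set_partitions"
  shows "image_mset Succ (arc_shuffle \<tau> \<theta>) =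
    (let n = part_size \<tau>; m = part_size \<theta> in
      image_mset (\<lambda>S. spread S (Succ \<tau>) \<union> spread ({1..n + m} - S) (Succ \<theta>))
        (mset_set {S. S \<subseteq> {1..n + m} \<and> card S = n}))"
proof -
  have "\<tau> \<in> set_partitions (part_size \<tau>)" "\<theta> \<in> set_partitions (part_size \<theta>)"
    using assms mem_all_set_partitions by auto
  from shift_union_set_partitions(2)[OF this] show ?thesis
    unfolding arc_shuffle_def Let_def multiset.map_comp comp_def
    by (intro image_mset_cong) auto
qed

lemma weakly_shuffle_compatible_Succ: "weakly_shuffle_compatible Succ"
  unfolding weakly_shuffle_compatible_def by (auto simp: image_Succ_arc_shuffle)

lemma Succ_subset: "Succ \<pi> \<subseteq> {1..<part_size \<pi>}"
  by (auto simp: Succ_def)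

lemma ex_set_partition_Succ:
  assumes "S \<subseteq> {1..<n}"
  shows "\<exists>\<pi>\<in>set_partitions n. Succ \<pi> = S"
proof -
  \<comment> \<open>The block of i consists of the positions carrying the same letter as i in the
    tie word of S; its letter repeats exactly at the elements of S.\<close>
  let ?b = "\<lambda>i. {j \<in> {1..n}. tie_letter S (j - 1) = tie_letter S (i - 1)}"
  let ?\<pi> = "?b ` {1..n}"
  have \<pi>: "?\<pi> \<in> set_partitions n"
    unfolding set_partitions_def partition_on_def disjoint_def by auto
  have eq: "tie_letter S (i - 1) = tie_letter S (Suc i - 1) \<longleftrightarrow> i \<in> S" if "i > 0" for i
    using that by (cases i) auto
  have *: "(\<exists>B\<in>?\<pi>. i \<in> B \<and> i + 1 \<in> B) \<longleftrightarrow> i \<in> S" if "i \<in> {1..<n}" for i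
  proof
    assume "\<exists>B\<in>?\<pi>. i \<in> B \<and> i + 1 \<in> B"
    then obtain k where "i \<in> ?b k" "i + 1 \<in> ?b k" by blast
    then have "tie_letter S (i - 1) = tie_letter S (i + 1 - 1)" by simp
    then show "i \<in> S" using eq[of i] that by simp
  next
    assume "i \<in> S"
    then have "tie_letter S (i - 1) = tie_letter S (Suc i - 1)" using eq[of i] that by simp
    then have "i \<in> ?b i" "i + 1 \<in> ?b i" using that by auto
    moreover have "?b i \<in> ?\<pi>" using that by (intro imageI) simp
    ultimately show "\<exists>B\<in>?\<pi>. i \<in> B \<and> i + 1 \<in> B" by blast
  qed
  have "Succ ?\<pi> = {i \<in> {1..<n}. i \<in> S}"
    unfolding Succ_def set_partitions_simps(2)[OF \<pi>] by (intro Collect_cong conj_cong refl *)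
  then have "Succ ?\<pi> = S" using assms by blast
  then show ?thesis using \<pi> by blast
qed

text \<open>Both multisets are indexed by the same position sets S, with equal \<open>spread\<close>
  formulas, because the tie sets of the two words are the succession sets of \<tau> and \<theta>.
  This matches the two products.\<close>

lemma image_Succ_arc_shuffle_shuffles:
  fixes \<tau> \<theta> :: "nat set set"
  defines "\<alpha> \<equiv> Comp (part_size \<tau>) (Succ \<tau>)" and "\<beta> \<equiv> Comp (part_size \<theta>) (Succ \<theta>)"
  assumes "\<tau> \<in> all_set_partitions" "\<theta> \<in> all_set_partitions"
  shows "image_mset Succ (arc_shuffle \<tau> \<theta>) =
    image_mset Tie (mset_set (shuffles (tie_word \<alpha>) (map ((+) (max_letter (tie_word \<alpha>))) (tie_word \<beta>))))"
proof -
  let ?n = "part_size \<tau>" and ?m = "part_size \<theta>"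
  let ?xs = "tie_word \<alpha>" and ?ys = "map ((+) (max_letter (tie_word \<alpha>))) (tie_word \<beta>)"
  let ?\<S> = "{S. S \<subseteq> {1..?n + ?m} \<and> card S = ?n}"
  have len: "length ?xs = ?n" "length ?ys = ?m"
    unfolding \<alpha>_def \<beta>_def by (simp_all only: length_map length_tie_word sum_list_Comp[OF Succ_subset])
  have "Tie ?xs = Succ \<tau>" "Tie (tie_word \<beta>) = Succ \<theta>"
    unfolding \<alpha>_def \<beta>_def by (simp_all only: Tie_tie_word composition_Comp[OF Succ_subset] Comp_set_Comp[OF Succ_subset])
  then have Tie: "Tie ?xs = Succ \<tau>" "Tie ?ys = Succ \<theta>"
    by (simp_all add: Tie_map_inj)
  have bij: "bij_betw (place ?xs ?ys) ?\<S> (shuffles ?xs ?ys)"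
    using bij_betw_place[OF disjoint_tie_words[of \<alpha> \<beta>]] unfolding len .
  have "mset_set (shuffles ?xs ?ys) = image_mset (place ?xs ?ys) (mset_set ?\<S>)"
    using bij by (simp add: bij_betw_def image_mset_mset_set)
  then have "image_mset Tie (mset_set (shuffles ?xs ?ys)) =
      image_mset (\<lambda>S. Tie (place ?xs ?ys S)) (mset_set ?\<S>)"
    by (simp add: multiset.map_comp comp_def)
  also have "\<dots> = image_mset (\<lambda>S. spread S (Succ \<tau>) \<union> spread ({1..?n + ?m} - S) (Succ \<theta>)) (mset_set ?\<S>)"
    using Tie_place[OF disjoint_tie_words[of \<alpha> \<beta>]] unfolding len Tie
    by (intro image_mset_cong) simp
  finally show ?thesis using assms(3,4) by (simp add: image_Succ_arc_shuffle Let_def)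
qed

section \<open>The algebra of quasisymmetric functions\<close>

text \<open>By injectivity, an identity in M may be checked after applying f, where it is an axiom
  of N. This spares a direct proof of associativity and commutativity for classes of
  partitions.\<close>

lemma algebra_pullback:
  assumes N: "algebra K N"
    and bij: "bij_betw f (carrier M) (carrier N)"
    and closed: "\<zero>\<^bsub>M\<^esub> \<in> carrier M" "\<one>\<^bsub>M\<^esub> \<in> carrier M"
      "\<And>x y. x \<in> carrier M \<Longrightarrow> y \<in> carrier M \<Longrightarrow> x \<oplus>\<^bsub>M\<^esub> y \<in> carrier M"
      "\<And>x y. x \<in> carrier M \<Longrightarrow> y \<in> carrier M \<Longrightarrow> x \<otimes>\<^bsub>M\<^esub> y \<in> carrier M"
      "\<And>c x. c \<in> carrier K \<Longrightarrow> x \<in> carrier M \<Longrightarrow> c \<odot>\<^bsub>M\<^esub> x \<in> carrier M"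
    and hom: "f \<zero>\<^bsub>M\<^esub> = \<zero>\<^bsub>N\<^esub>" "f \<one>\<^bsub>M\<^esub> = \<one>\<^bsub>N\<^esub>"
      "\<And>x y. x \<in> carrier M \<Longrightarrow> y \<in> carrier M \<Longrightarrow> f (x \<oplus>\<^bsub>M\<^esub> y) = f x \<oplus>\<^bsub>N\<^esub> f y"
      "\<And>x y. x \<in> carrier M \<Longrightarrow> y \<in> carrier M \<Longrightarrow> f (x \<otimes>\<^bsub>M\<^esub> y) = f x \<otimes>\<^bsub>N\<^esub> f y"
      "\<And>c x. c \<in> carrier K \<Longrightarrow> x \<in> carrier M \<Longrightarrow> f (c \<odot>\<^bsub>M\<^esub> x) = c \<odot>\<^bsub>N\<^esub> f x"
  shows "algebra K M"
proof -
  interpret N: algebra K N by (rule N)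
  have f: "f x \<in> carrier N" if "x \<in> carrier M" for x
    using bij that by (rule bij_betw_apply)
  have eqI: "x = y" if "f x = f y" "x \<in> carrier M" "y \<in> carrier M" for x y
    using bij that unfolding bij_betw_def inj_on_def by blast
  \<comment> \<open>Negatives are an existence claim and the one place that uses surjectivity of
    f.\<close>
  have neg: "\<exists>y\<in>carrier M. y \<oplus>\<^bsub>M\<^esub> x = \<zero>\<^bsub>M\<^esub>" if x: "x \<in> carrier M" for x
  proof -
    obtain y where y: "y \<in> carrier M" "f y = \<ominus>\<^bsub>N\<^esub> f x"
      using bij N.M.a_inv_closed[OF f[OF x]] unfolding bij_betw_def by (metis imageE)
    have "y \<oplus>\<^bsub>M\<^esub> x = \<zero>\<^bsub>M\<^esub>"
      by (rule eqI) (simp_all add: closed hom x y f N.M.l_neg)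
    then show ?thesis using y by blast
  qed
  show ?thesis
  proof (rule algebraI)
    show "cring K" by (rule N.R.is_cring)
    show "cring M"
    proof (rule cringI)
      show "abelian_group M"
        by (rule abelian_groupI)
          (auto intro!: eqI neg simp: closed hom f N.M.a_ac)
      show "Group.comm_monoid M"
        by (rule comm_monoidI) (auto intro!: eqI simp: closed hom f N.m_ac)
    qed (rule eqI, auto simp: closed hom f N.l_distr)
  qed (rule closed eqI;
      simp add: closed hom f N.smult_l_distr N.smult_r_distr N.smult_assoc1 N.smult_assoc2)+
qed

section \<open>The Cauchy product of power series\<close>

definition decompositions :: "(nat \<Rightarrow>\<^sub>0 nat) \<Rightarrow> ((nat \<Rightarrow>\<^sub>0 nat) \<times> (nat \<Rightarrow>\<^sub>0 nat)) set" where
  "decompositions m = {(a, b). a + b = m}"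

text \<open>Taken on all series, so that the ring laws are available before products are known to
  stay quasisymmetric.\<close>

definition series_mult :: "series \<Rightarrow> series \<Rightarrow> series" where
  "series_mult f g = (\<lambda>m. \<Sum>(a, b)\<in>decompositions m. f a * g b)"

lemma QSym_simps:
  "carrier QSym = {f. quasisymmetric f}"
  "f \<otimes>\<^bsub>QSym\<^esub> g = series_mult f g"
  "\<one>\<^bsub>QSym\<^esub> = (\<lambda>m. if m = 0 then 1 else 0)"
  "\<zero>\<^bsub>QSym\<^esub> = (\<lambda>m. 0)"
  "f \<oplus>\<^bsub>QSym\<^esub> g = (\<lambda>m. f m + g m)"
  "c \<odot>\<^bsub>QSym\<^esub> f = (\<lambda>m. c * f m)"
  by (simp_all add: QSym_def series_mult_def decompositions_def)

lemma rat_field_simps: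
  "carrier rat_field = UNIV" "x \<otimes>\<^bsub>rat_field\<^esub> y = x * y" "\<one>\<^bsub>rat_field\<^esub> = 1"
  "x \<oplus>\<^bsub>rat_field\<^esub> y = x + y"
  by (simp_all add: ring_of_type_algebra_def)

text \<open>The first factor determines the decomposition; its exponents are at most the degree of m
  and vanish off the support of m. Without finiteness the sums in the product would default to
  0.\<close>

lemma finite_decompositions [simp]: "finite (decompositions m)"
proof -
  let ?F = "{f. \<forall>i. (i \<in> Poly_Mapping.keys m \<longrightarrow> f i \<in> {..monomial_degree m})
    \<and> (i \<notin> Poly_Mapping.keys m \<longrightarrow> f i = (0::nat))}"
  have "(Poly_Mapping.lookup \<circ> fst) ` decompositions m \<subseteq> ?F"
  proof (safe, simp_all add: comp_def)
    fix a b i assume ab: "(a, b) \<in> decompositions m"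
    then have m: "Poly_Mapping.lookup m i = Poly_Mapping.lookup a i + Poly_Mapping.lookup b i"
      by (auto simp: decompositions_def lookup_add)
    show "Poly_Mapping.lookup a i \<le> monomial_degree m" if "i \<in> Poly_Mapping.keys m"
      using member_le_sum[OF that, of "Poly_Mapping.lookup m"] m
      by (simp add: monomial_degree_def)
    show "Poly_Mapping.lookup a i = 0" if "i \<notin> Poly_Mapping.keys m"
      using that m by (simp add: in_keys_iff)
  qed
  moreover have "finite ?F" by (intro finite_set_of_finite_funs) auto
  ultimately have "finite ((Poly_Mapping.lookup \<circ> fst) ` decompositions m)"
    by (rule finite_subset)
  moreover have "inj_on (Poly_Mapping.lookup \<circ> fst) (decompositions m)"
    by (rule inj_onI) (auto simp: decompositions_def poly_mapping_eq_iff[symmetric])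
  ultimately show ?thesis by (rule finite_imageD)
qed

lemma series_mult_commute: "series_mult f g = series_mult g f"
  unfolding series_mult_def
  by (rule ext, rule sum.reindex_bij_witness[where i = prod.swap and j = prod.swap])
    (auto simp: decompositions_def add.commute)

text \<open>Both sides sum over triples (a, b, c) with a + b + c = m. The reindexing exchanges the
  groupings (a + b) + c and a + (b + c).\<close>

lemma series_mult_assoc: "series_mult (series_mult f g) h = series_mult f (series_mult g h)"
proof
  fix m
  have "series_mult (series_mult f g) h m =
      (\<Sum>u\<in>decompositions m. \<Sum>v\<in>decompositions (fst u). f (fst v) * g (snd v) * h (snd u))"
    by (simp add: series_mult_def sum_distrib_right case_prod_unfold)
  also have "\<dots> = (\<Sum>(u, v)\<in>(SIGMA u:decompositions m. decompositions (fst u)).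
      f (fst v) * g (snd v) * h (snd u))"
    by (rule sum.Sigma) auto
  also have "\<dots> = (\<Sum>(u, v)\<in>(SIGMA u:decompositions m. decompositions (snd u)).
      f (fst u) * (g (fst v) * h (snd v)))"
    by (rule sum.reindex_bij_witness[where
          i = "\<lambda>((a, q), (b, c)). ((a + b, c), (a, b))" and
          j = "\<lambda>((p, c), (a, b)). ((a, b + c), (b, c))"])
      (auto simp: decompositions_def add.assoc)
  also have "\<dots> = (\<Sum>u\<in>decompositions m. \<Sum>v\<in>decompositions (snd u).
      f (fst u) * (g (fst v) * h (snd v)))"
    by (rule sum.Sigma[symmetric]) auto
  also have "\<dots> = series_mult f (series_mult g h) m"
    by (simp add: series_mult_def sum_distrib_left case_prod_unfold)
  finally show "series_mult (series_mult f g) h m = series_mult f (series_mult g h) m" .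
qed

lemma series_mult_one: "series_mult (\<lambda>m. if m = 0 then 1 else 0) f = f"
proof
  fix m
  have "(\<Sum>(a, b)\<in>decompositions m. (if a = 0 then 1 else 0) * f b) =
      (\<Sum>u\<in>decompositions m. if u = (0, m) then f m else 0)"
    by (rule sum.cong) (auto simp: decompositions_def split: if_splits)
  also have "\<dots> = f m"
    by (subst sum.delta[OF finite_decompositions]) (auto simp: decompositions_def)
  finally show "series_mult (\<lambda>m. if m = 0 then 1 else 0) f m = f m"
    by (simp add: series_mult_def)
qed

lemma series_mult_add_left:
  "series_mult (\<lambda>m. f m + g m) h = (\<lambda>m. series_mult f h m + series_mult g h m)"
  by (rule ext) (simp add: series_mult_def sum.distrib[symmetric] distrib_right case_prod_unfold)

lemma series_mult_scale_left: "series_mult (\<lambda>m. c * f m) g = (\<lambda>m. c * series_mult f g m)"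
  by (rule ext) (simp add: series_mult_def sum_distrib_left case_prod_unfold mult.assoc)

lemma series_mult_sum_left:
  "series_mult (\<lambda>m. \<Sum>i\<in>A. f i m) g = (\<lambda>m. \<Sum>i\<in>A. series_mult (f i) g m)"
  unfolding series_mult_def case_prod_unfold sum_distrib_right by (intro ext sum.swap)

lemma series_mult_sum_right:
  "series_mult f (\<lambda>m. \<Sum>i\<in>A. g i m) = (\<lambda>m. \<Sum>i\<in>A. series_mult f (g i) m)"
  by (simp add: series_mult_commute[of f] series_mult_sum_left)

lemma series_mult_scale_right: "series_mult f (\<lambda>m. c * g m) = (\<lambda>m. c * series_mult f g m)"
  by (simp add: series_mult_commute[of f] series_mult_scale_left)

section \<open>Quasisymmetric series as a module and, given closure, an algebra\<close>

lemma quasisymmetric_zero: "quasisymmetric (\<lambda>m. 0)"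
  by (simp add: quasisymmetric_def)

lemma quasisymmetric_scale: "quasisymmetric f \<Longrightarrow> quasisymmetric (\<lambda>m. c * f m)"
  by (auto simp: quasisymmetric_def)

lemma quasisymmetric_add:
  assumes "quasisymmetric f" "quasisymmetric g"
  shows "quasisymmetric (\<lambda>m. f m + g m)"
proof -
  obtain d e where "\<And>m. f m \<noteq> 0 \<Longrightarrow> monomial_degree m \<le> d" "\<And>m. g m \<noteq> 0 \<Longrightarrow> monomial_degree m \<le> e"
    using assms unfolding quasisymmetric_def by blast
  then have "\<forall>m. f m + g m \<noteq> 0 \<longrightarrow> monomial_degree m \<le> max d e"
    by (metis add_0 le_max_iff_disj)
  then show ?thesis using assms unfolding quasisymmetric_def by metis
qed

text \<open>The exponent of the first listed variable is at least the first part, which is positive.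
  Hence being constant depends on \<alpha> alone, which makes the unit series
  quasisymmetric.\<close>

lemma monomial_eq_0_iff:
  assumes "composition \<alpha>" "length is = length \<alpha>"
  shows "monomial is \<alpha> = 0 \<longleftrightarrow> \<alpha> = []"
proof (cases \<alpha>)
  case (Cons a \<alpha>')
  then obtain i is' where "is = i # is'" using assms by (cases "is") auto
  then have "Poly_Mapping.lookup (monomial is \<alpha>) i \<ge> a" "a > 0"
    using Cons assms by (simp_all add: monomial_def lookup_add composition_def)
  then show ?thesis using Cons by auto
qed (simp add: monomial_def)

lemma quasisymmetric_one: "quasisymmetric (\<lambda>m. if m = 0 then 1 else 0)"
  by (auto simp: quasisymmetric_def monomial_degree_def monomial_eq_0_iff)

lemma quasisymmetric_sum:
  "(\<And>i. i \<in> A \<Longrightarrow> quasisymmetric (f i)) \<Longrightarrow> quasisymmetric (\<lambda>m. \<Sum>i\<in>A. f i m)"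
  by (induction A rule: infinite_finite_induct) (auto simp: quasisymmetric_zero quasisymmetric_add)

lemma abelian_group_QSym: "abelian_group QSym"
proof (rule abelian_groupI)
  fix f assume f: "f \<in> carrier QSym"
  then have "quasisymmetric (\<lambda>m. - 1 * f m)"
    by (intro quasisymmetric_scale) (simp add: QSym_simps)
  then show "\<exists>g\<in>carrier QSym. g \<oplus>\<^bsub>QSym\<^esub> f = \<zero>\<^bsub>QSym\<^esub>"
    by (intro bexI[of _ "\<lambda>m. - 1 * f m"]) (auto simp: QSym_simps)
qed (auto simp: QSym_simps quasisymmetric_zero quasisymmetric_add add.assoc add.commute)

text \<open>Turns \<open>finsum\<close>, which unfolds only over elements of the carrier, into a
  pointwise sum of coefficients.\<close>

lemma finsum_QSym:
  assumes "finite A" "\<And>i. i \<in> A \<Longrightarrow> quasisymmetric (f i)"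
  shows "(\<Oplus>\<^bsub>QSym\<^esub>i\<in>A. f i) = (\<lambda>m. \<Sum>i\<in>A. f i m)"
proof -
  interpret Q: abelian_group QSym by (rule abelian_group_QSym)
  show ?thesis
    using assms
  proof (induction A rule: finite_induct)
    case empty
    then show ?case by (simp add: QSym_simps)
  next
    case (insert i A)
    have "finsum QSym f (insert i A) = f i \<oplus>\<^bsub>QSym\<^esub> finsum QSym f A"
      by (rule Q.finsum_insert) (use insert in \<open>auto simp: QSym_simps\<close>)
    then show ?case using insert by (simp add: QSym_simps)
  qed
qed

text \<open>Closure under products is left as a hypothesis, to be supplied by a tie basis.\<close>

lemma algebra_QSym:
  assumes "\<And>f g. quasisymmetric f \<Longrightarrow> quasisymmetric g \<Longrightarrow> quasisymmetric (series_mult f g)"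
  shows "algebra rat_field QSym"
proof (rule algebraI)
  show "cring rat_field" by (rule cring_from_type_algebra)
  show "cring QSym"
  proof (rule cringI[OF abelian_group_QSym])
    show "Group.comm_monoid QSym"
      by (rule comm_monoidI)
        (auto simp: QSym_simps assms quasisymmetric_one series_mult_assoc series_mult_one
          intro: series_mult_commute)
  qed (simp add: QSym_simps series_mult_add_left)
qed (simp_all add: QSym_simps rat_field_simps quasisymmetric_scale series_mult_scale_left algebra_simps)

section \<open>Linear extension of a family of series\<close>

text \<open>Serves both for expansions in a tie basis and, with b running over classes, for the
  isomorphism itself.\<close>

definition lin_ext :: "('i \<Rightarrow> series) \<Rightarrow> ('i \<Rightarrow>\<^sub>0 rat) \<Rightarrow> series" where
  "lin_ext b x = (\<lambda>m. \<Sum>i\<in>Poly_Mapping.keys x. Poly_Mapping.lookup x i * b i m)"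

text \<open>Sums and scalings can lose keys by cancellation; a fixed finite superset allows termwise
  comparison.\<close>

lemma lin_ext_superset:
  assumes "finite A" "Poly_Mapping.keys x \<subseteq> A"
  shows "lin_ext b x m = (\<Sum>i\<in>A. Poly_Mapping.lookup x i * b i m)"
  unfolding lin_ext_def
  by (rule sum.mono_neutral_left) (use assms in \<open>auto simp: in_keys_iff\<close>)

lemma lin_ext_zero [simp]: "lin_ext b 0 = (\<lambda>m. 0)"
  by (simp add: lin_ext_def)

lemma lin_ext_add: "lin_ext b (x + y) = (\<lambda>m. lin_ext b x m + lin_ext b y m)"
proof
  fix m
  let ?A = "Poly_Mapping.keys x \<union> Poly_Mapping.keys y"
  have "finite ?A" "Poly_Mapping.keys (x + y) \<subseteq> ?A" by (simp_all add: keys_add)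
  then show "lin_ext b (x + y) m = lin_ext b x m + lin_ext b y m"
    using lin_ext_superset[of ?A x b m] lin_ext_superset[of ?A y b m] lin_ext_superset[of ?A "x + y" b m]
    by (simp add: lookup_add distrib_right sum.distrib)
qed

lemma lookup_scale [simp]:
  "Poly_Mapping.lookup (Poly_Mapping.map ((*) c) x) i = c * Poly_Mapping.lookup x i" for c :: rat
  by (simp add: Poly_Mapping.map.rep_eq when_def)

lemma keys_scale: "Poly_Mapping.keys (Poly_Mapping.map ((*) c) x) \<subseteq> Poly_Mapping.keys x" for c :: rat
  by (auto simp: in_keys_iff)

lemma lin_ext_scale: "lin_ext b (Poly_Mapping.map ((*) c) x) = (\<lambda>m. c * lin_ext b x m)"
proof
  fix m
  have "lin_ext b (Poly_Mapping.map ((*) c) x) m =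
      (\<Sum>i\<in>Poly_Mapping.keys x. c * Poly_Mapping.lookup x i * b i m)"
    by (simp add: lin_ext_superset[OF finite_keys keys_scale])
  then show "lin_ext b (Poly_Mapping.map ((*) c) x) m = c * lin_ext b x m"
    by (simp add: lin_ext_def sum_distrib_left mult.assoc)
qed

lemma lin_ext_single: "lin_ext b (Poly_Mapping.single i c) = (\<lambda>m. c * b i m)"
  by (rule ext) (simp add: lin_ext_superset[of "{i}"])

lemma lin_ext_sum: "lin_ext b (\<Sum>j\<in>A. x j) = (\<lambda>m. \<Sum>j\<in>A. lin_ext b (x j) m)"
  by (induction A rule: infinite_finite_induct) (auto simp: lin_ext_add)

lemma lin_ext_sum_mset: "lin_ext b (\<Sum>j\<in>#A. x j) = (\<lambda>m. \<Sum>j\<in>#A. lin_ext b (x j) m)"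
  by (induction A) (auto simp: lin_ext_add)

lemma lin_ext_uminus: "lin_ext b (- x) = (\<lambda>m. - lin_ext b x m)"
  by (rule ext) (simp add: lin_ext_def keys_minus sum_negf)

lemma series_mult_lin_ext:
  "series_mult (lin_ext b x) (lin_ext c y) = (\<lambda>m. \<Sum>i\<in>Poly_Mapping.keys x. \<Sum>j\<in>Poly_Mapping.keys y.
     Poly_Mapping.lookup x i * Poly_Mapping.lookup y j * series_mult (b i) (c j) m)"
  unfolding lin_ext_def series_mult_sum_left series_mult_sum_right
    series_mult_scale_left series_mult_scale_right
  by (simp add: sum_distrib_left mult_ac)

lemma quasisymmetric_lin_ext:
  "(\<And>i. i \<in> Poly_Mapping.keys x \<Longrightarrow> quasisymmetric (b i)) \<Longrightarrow> quasisymmetric (lin_ext b x)"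
  unfolding lin_ext_def by (intro quasisymmetric_sum quasisymmetric_scale)

lemma poly_mapping_eq_sum_single:
  "x = (\<Sum>i\<in>Poly_Mapping.keys x. Poly_Mapping.single i (Poly_Mapping.lookup x i))"
proof (rule poly_mapping_eqI)
  fix k
  have "Poly_Mapping.lookup (\<Sum>i\<in>Poly_Mapping.keys x. Poly_Mapping.single i (Poly_Mapping.lookup x i)) k =
      (\<Sum>i\<in>Poly_Mapping.keys x. if i = k then Poly_Mapping.lookup x k else 0)"
    unfolding lookup_sum by (rule sum.cong) (auto simp: lookup_single when_def)
  then show "Poly_Mapping.lookup x k =
      Poly_Mapping.lookup (\<Sum>i\<in>Poly_Mapping.keys x. Poly_Mapping.single i (Poly_Mapping.lookup x i)) k"
    by (simp add: in_keys_iff)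
qed

section \<open>The algebra of the succession set\<close>

abbreviation Succ_classes :: "nat set set set set" where
  "Succ_classes \<equiv> st_class Succ ` all_set_partitions"

text \<open>The chosen representative does not matter: all members of a class share size and
  succession set.\<close>

definition class_comp :: "nat set set set \<Rightarrow> nat list" where
  "class_comp C = (let \<pi> = SOME \<pi>. \<pi> \<in> C in Comp (part_size \<pi>) (Succ \<pi>))"

lemma class_comp_st_class:
  assumes "\<pi> \<in> all_set_partitions"
  shows "class_comp (st_class Succ \<pi>) = Comp (part_size \<pi>) (Succ \<pi>)"
proof -
  have "(SOME \<rho>. \<rho> \<in> st_class Succ \<pi>) \<in> st_class Succ \<pi>"
    by (rule someI[of _ \<pi>]) (simp add: st_class_def assms)
  then show ?thesis by (simp add: class_comp_def Let_def st_class_def)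
qed

text \<open>A composition gives back the size as its sum and the succession set as
  \<open>Comp_set\<close>, hence injectivity. Surjectivity holds since every subset of
  \<open>{1..<n}\<close> is a succession set.\<close>

lemma bij_betw_class_comp: "bij_betw class_comp Succ_classes {\<alpha>. composition \<alpha>}"
proof (rule bij_betw_imageI)
  show "inj_on class_comp Succ_classes"
  proof (intro inj_onI, clarify)
    fix \<pi> \<rho> assume *: "\<pi> \<in> all_set_partitions" "\<rho> \<in> all_set_partitions"
      "class_comp (st_class Succ \<pi>) = class_comp (st_class Succ \<rho>)"
    then have "Comp (part_size \<pi>) (Succ \<pi>) = Comp (part_size \<rho>) (Succ \<rho>)"
      by (simp add: class_comp_st_class)
    then have "part_size \<pi> = part_size \<rho>" "Succ \<pi> = Succ \<rho>"
      using sum_list_Comp[OF Succ_subset] Comp_set_Comp[OF Succ_subset] by metis+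
    then show "st_class Succ \<pi> = st_class Succ \<rho>" by (simp add: st_class_def)
  qed
  have "\<alpha> \<in> class_comp ` Succ_classes" if \<alpha>: "composition \<alpha>" for \<alpha>
  proof -
    obtain \<pi> where \<pi>: "\<pi> \<in> set_partitions (sum_list \<alpha>)" "Succ \<pi> = Comp_set \<alpha>"
      using ex_set_partition_Succ[OF Comp_set_subset[OF \<alpha>]] by blast
    then have "\<pi> \<in> all_set_partitions" by (auto simp: all_set_partitions_def)
    moreover from this have "class_comp (st_class Succ \<pi>) = \<alpha>"
      using \<pi> set_partitions_simps(2)[OF \<pi>(1)] Comp_Comp_set[OF \<alpha>] by (simp add: class_comp_st_class)
    ultimately show ?thesis by blast
  qed
  then show "class_comp ` Succ_classes = {\<alpha>. composition \<alpha>}"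
    by (auto simp: class_comp_st_class composition_Comp[OF Succ_subset])
qed

lemma composition_class_comp: "C \<in> Succ_classes \<Longrightarrow> composition (class_comp C)"
  using bij_betw_apply[OF bij_betw_class_comp] by blast

section \<open>Carrier and operations of the partition algebra\<close>

lemma keys_sum_subset:
  "(\<And>j. j \<in> A \<Longrightarrow> Poly_Mapping.keys (x j) \<subseteq> K) \<Longrightarrow> Poly_Mapping.keys (\<Sum>j\<in>A. x j) \<subseteq> K"
  by (induction A rule: infinite_finite_induct) (auto dest!: subsetD[OF keys_add])

lemma keys_sum_mset_subset:
  "(\<And>j. j \<in># A \<Longrightarrow> Poly_Mapping.keys (x j) \<subseteq> K) \<Longrightarrow> Poly_Mapping.keys (\<Sum>j\<in>#A. x j) \<subseteq> K"
  by (induction A) (auto dest!: subsetD[OF keys_add])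

lemma partition_algebra_simps:
  "carrier (partition_algebra st) = {x. Poly_Mapping.keys x \<subseteq> st_class st ` all_set_partitions}"
  "x \<otimes>\<^bsub>partition_algebra st\<^esub> y = (\<Sum>C\<in>Poly_Mapping.keys x. \<Sum>D\<in>Poly_Mapping.keys y.
        Poly_Mapping.map ((*) (Poly_Mapping.lookup x C * Poly_Mapping.lookup y D)) (class_prod st C D))"
  "\<one>\<^bsub>partition_algebra st\<^esub> = basis_elem st {}"
  "\<zero>\<^bsub>partition_algebra st\<^esub> = 0"
  "x \<oplus>\<^bsub>partition_algebra st\<^esub> y = x + y"
  "c \<odot>\<^bsub>partition_algebra st\<^esub> x = Poly_Mapping.map ((*) c) x"
  by (simp_all add: partition_algebra_def)

text \<open>Classes are nonempty, so the choice inside \<open>class_prod\<close> really picks a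
  member, and that member generates the same class.\<close>

lemma class_representative:
  assumes "C \<in> st_class st ` all_set_partitions"
  obtains \<tau> where "\<tau> \<in> all_set_partitions" "(SOME \<tau>. \<tau> \<in> C) = \<tau>" "C = st_class st \<tau>"
proof -
  obtain \<pi> where \<pi>: "\<pi> \<in> all_set_partitions" "C = st_class st \<pi>" using assms by blast
  then have "\<pi> \<in> C" by (simp add: st_class_def)
  then have "(SOME \<tau>. \<tau> \<in> C) \<in> C" by (rule someI)
  then have "(SOME \<tau>. \<tau> \<in> C) \<in> all_set_partitions" "C = st_class st (SOME \<tau>. \<tau> \<in> C)"
    using \<pi>(2) by (auto simp: st_class_def)
  then show ?thesis using that by blast
qed

lemma keys_class_prod:
  assumes "C \<in> st_class st ` all_set_partitions" "D \<in> st_class st ` all_set_partitions"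
  shows "Poly_Mapping.keys (class_prod st C D) \<subseteq> st_class st ` all_set_partitions"
proof -
  from assms(1) obtain \<tau> where \<tau>: "\<tau> \<in> all_set_partitions" "(SOME \<tau>. \<tau> \<in> C) = \<tau>"
    by (rule class_representative)
  from assms(2) obtain \<theta> where \<theta>: "\<theta> \<in> all_set_partitions" "(SOME \<theta>. \<theta> \<in> D) = \<theta>"
    by (rule class_representative)
  show ?thesis
    unfolding class_prod_def \<tau>(2) \<theta>(2) basis_elem_def
    using arc_shuffle_closed[OF \<tau>(1) \<theta>(1)] by (intro keys_sum_mset_subset) auto
qed

lemma partition_algebra_closed:
  "0 \<in> carrier (partition_algebra st)"
  "x \<in> carrier (partition_algebra st) \<Longrightarrow> y \<in> carrier (partition_algebra st) \<Longrightarrow>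
    x + y \<in> carrier (partition_algebra st)"
  "x \<in> carrier (partition_algebra st) \<Longrightarrow> Poly_Mapping.map ((*) c) x \<in> carrier (partition_algebra st)"
  "x \<in> carrier (partition_algebra st) \<Longrightarrow> y \<in> carrier (partition_algebra st) \<Longrightarrow>
    x \<otimes>\<^bsub>partition_algebra st\<^esub> y \<in> carrier (partition_algebra st)"
  "\<pi> \<in> all_set_partitions \<Longrightarrow> basis_elem st \<pi> \<in> carrier (partition_algebra st)"
proof -
  show "x \<otimes>\<^bsub>partition_algebra st\<^esub> y \<in> carrier (partition_algebra st)"
    if "x \<in> carrier (partition_algebra st)" "y \<in> carrier (partition_algebra st)"
    unfolding partition_algebra_simps mem_Collect_eq
    by (intro keys_sum_subset order_trans[OF keys_scale] keys_class_prod)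
      (use that in \<open>auto simp: partition_algebra_simps\<close>)
  show "x + y \<in> carrier (partition_algebra st)"
    if "x \<in> carrier (partition_algebra st)" "y \<in> carrier (partition_algebra st)"
    using that keys_add[of x y] by (auto simp: partition_algebra_simps)
  show "Poly_Mapping.map ((*) c) x \<in> carrier (partition_algebra st)"
    if "x \<in> carrier (partition_algebra st)"
    using that keys_scale[of c x] by (auto simp: partition_algebra_simps)
qed (auto simp: partition_algebra_simps basis_elem_def)

lemma empty_set_partition: "{} \<in> all_set_partitions" "part_size {} = 0" "Succ {} = {}"
proof -
  have "{} \<in> set_partitions 0" by (simp add: set_partitions_def partition_on_def)
  then show "{} \<in> all_set_partitions" by (auto simp: all_set_partitions_def)
qed (simp_all add: part_size_def Succ_def)

section \<open>The isomorphism\<close>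

locale tie_basis_of_QSym =
  fixes T :: "nat list \<Rightarrow> series"
  assumes tie_basis: "tie_basis T"
begin

lemma T_closed: "composition \<alpha> \<Longrightarrow> quasisymmetric (T \<alpha>)"
  using tie_basis by (auto simp: tie_basis_def basis_family_def QSym_simps)

lemma finsum_T:
  assumes "Poly_Mapping.keys c \<subseteq> {\<alpha>. composition \<alpha>}"
  shows "(\<Oplus>\<^bsub>QSym\<^esub>\<alpha>\<in>Poly_Mapping.keys c. Poly_Mapping.lookup c \<alpha> \<odot>\<^bsub>QSym\<^esub> T \<alpha>) = lin_ext T c"
  using assms unfolding lin_ext_def
  by (subst finsum_QSym) (auto simp: QSym_simps intro!: quasisymmetric_scale T_closed)

lemma ex1_lin_ext_T:
  assumes "quasisymmetric f"
  shows "\<exists>!c. Poly_Mapping.keys c \<subseteq> {\<alpha>. composition \<alpha>} \<and> f = lin_ext T c"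
proof -
  have "\<exists>!c. Poly_Mapping.keys c \<subseteq> {\<alpha>. composition \<alpha>} \<and>
      f = (\<Oplus>\<^bsub>QSym\<^esub>\<alpha>\<in>Poly_Mapping.keys c. Poly_Mapping.lookup c \<alpha> \<odot>\<^bsub>QSym\<^esub> T \<alpha>)"
    using tie_basis assms unfolding tie_basis_def basis_family_def by (simp add: QSym_simps)
  then show ?thesis using finsum_T by (simp cong: conj_cong)
qed

text \<open>Linear independence of T, read off from the unique expansion of the zero series.\<close>

lemma lin_ext_T_eq_0:
  assumes "Poly_Mapping.keys c \<subseteq> {\<alpha>. composition \<alpha>}" "lin_ext T c = (\<lambda>m. 0)"
  shows "c = 0"
proof -
  have "Poly_Mapping.keys 0 \<subseteq> {\<alpha>. composition \<alpha>} \<and> (\<lambda>m. 0) = lin_ext T 0" by simp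
  moreover have "Poly_Mapping.keys c \<subseteq> {\<alpha>. composition \<alpha>} \<and> (\<lambda>m. 0) = lin_ext T c"
    using assms by simp
  ultimately show ?thesis
    using ex1_lin_ext_T[OF quasisymmetric_zero] by blast
qed

lemma series_mult_T:
  assumes "composition \<alpha>" "composition \<beta>"
  shows "series_mult (T \<alpha>) (T \<beta>) =
    (\<lambda>m. \<Sum>v\<in>shuffles (tie_word \<alpha>) (map ((+) (max_letter (tie_word \<alpha>))) (tie_word \<beta>)).
      T (Comp (length v) (Tie v)) m)"
proof -
  have "quasisymmetric (T (Comp (length v) (Tie v)))" for v
    by (intro T_closed composition_Comp) (auto simp: Tie_def)
  then have "(\<Oplus>\<^bsub>QSym\<^esub>v\<in>shuffles (tie_word \<alpha>) (map ((+) (max_letter (tie_word \<alpha>))) (tie_word \<beta>)).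
      T (Comp (length v) (Tie v))) =
    (\<lambda>m. \<Sum>v\<in>shuffles (tie_word \<alpha>) (map ((+) (max_letter (tie_word \<alpha>))) (tie_word \<beta>)).
      T (Comp (length v) (Tie v)) m)"
    by (intro finsum_QSym) auto
  then show ?thesis
    using tie_basis assms by (simp add: tie_basis_def QSym_simps(2))
qed

text \<open>Expand both factors in T: by the product rule each product of two basis elements is a
  finite sum of basis elements, hence quasisymmetric.\<close>

lemma quasisymmetric_mult:
  assumes "quasisymmetric f" "quasisymmetric g"
  shows "quasisymmetric (series_mult f g)"
proof -
  obtain c d where c: "Poly_Mapping.keys c \<subseteq> {\<alpha>. composition \<alpha>}" "f = lin_ext T c"
    and d: "Poly_Mapping.keys d \<subseteq> {\<alpha>. composition \<alpha>}" "g = lin_ext T d"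
    using ex1_lin_ext_T[OF assms(1)] ex1_lin_ext_T[OF assms(2)] by blast
  have T: "quasisymmetric (series_mult (T \<alpha>) (T \<beta>))" if "composition \<alpha>" "composition \<beta>" for \<alpha> \<beta>
    unfolding series_mult_T[OF that]
    by (intro quasisymmetric_sum T_closed composition_Comp) (auto simp: Tie_def)
  show ?thesis
    unfolding c(2) d(2) series_mult_lin_ext
    by (intro quasisymmetric_sum quasisymmetric_scale T) (use c d in auto)
qed

lemma is_algebra: "algebra rat_field QSym"
  using quasisymmetric_mult by (rule algebra_QSym)

text \<open>The tie words of \<open>[]\<close> are empty, so \<open>T []\<close> is a left unit on the basis, hence on everything.\<close>

lemma T_Nil: "T [] = (\<lambda>m. if m = 0 then 1 else 0)"
proof -
  have unit: "series_mult (T []) (T \<beta>) = T \<beta>" if \<beta>: "composition \<beta>" for \<beta>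
  proof -
    \<comment> \<open>The first tie word is empty, so its largest letter is read as 0 and the second
      word is not shifted.\<close>
    have "map ((+) 0) w = w" for w :: "nat list" by (induction w) auto
    then show ?thesis
      using \<beta> by (simp add: series_mult_T composition_def tie_word_def[of "[]"] max_letter_def
          Tie_tie_word Comp_Comp_set)
  qed
  obtain c where c: "Poly_Mapping.keys c \<subseteq> {\<alpha>. composition \<alpha>}"
    "(\<lambda>m. if m = 0 then 1 else 0) = lin_ext T c"
    using ex1_lin_ext_T[OF quasisymmetric_one] by blast
  \<comment> \<open>Multiply \<open>T []\<close> by the unit series: this is \<open>T []\<close> by
    the unit law, and the unit series by expanding it in the basis.\<close>
  have "T [] = series_mult (T []) (\<lambda>m. if m = 0 then 1 else 0)"
    by (metis series_mult_commute series_mult_one)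
  also have "\<dots> = lin_ext (\<lambda>\<beta>. series_mult (T []) (T \<beta>)) c"
    unfolding c(2) lin_ext_def series_mult_sum_right series_mult_scale_right ..
  also have "\<dots> = lin_ext T c"
    unfolding lin_ext_def using c(1) unit by (intro ext sum.cong) auto
  finally show ?thesis using c(2) by simp
qed

definition \<phi> :: "(nat set set set \<Rightarrow>\<^sub>0 rat) \<Rightarrow> series" where
  "\<phi> = lin_ext (\<lambda>C. T (class_comp C))"

lemma \<phi>_closed: "x \<in> carrier (partition_algebra Succ) \<Longrightarrow> quasisymmetric (\<phi> x)"
  unfolding \<phi>_def by (intro quasisymmetric_lin_ext T_closed composition_class_comp)
    (auto simp: partition_algebra_simps)

lemma \<phi>_basis_elem:
  "\<pi> \<in> all_set_partitions \<Longrightarrow> \<phi> (basis_elem Succ \<pi>) = T (Comp (part_size \<pi>) (Succ \<pi>))"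
  by (simp add: \<phi>_def basis_elem_def lin_ext_single class_comp_st_class)

lemma linear_map_\<phi>: "linear_map rat_field (partition_algebra Succ) QSym \<phi>"
  using \<phi>_closed unfolding linear_map_def
  by (auto simp: partition_algebra_simps(5,6) QSym_simps \<phi>_def lin_ext_add lin_ext_scale)

text \<open>Reduces the claim about an arbitrary linear map to \<phi>. Agreement is asserted on the
  carrier only, since nothing constrains \<psi> elsewhere.\<close>

lemma linear_map_unique:
  assumes lin: "linear_map rat_field (partition_algebra Succ) QSym \<psi>"
    and basis: "\<And>\<pi>. \<pi> \<in> all_set_partitions \<Longrightarrow> \<psi> (basis_elem Succ \<pi>) = T (Comp (part_size \<pi>) (Succ \<pi>))"
    and x: "x \<in> carrier (partition_algebra Succ)"
  shows "\<psi> x = \<phi> x"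
proof -
  let ?P = "carrier (partition_algebra Succ)"
  have add: "\<psi> (u + v) = (\<lambda>m. \<psi> u m + \<psi> v m)" if "u \<in> ?P" "v \<in> ?P" for u v
    using lin that by (simp add: linear_map_def partition_algebra_simps(5) QSym_simps)
  have scale: "\<psi> (Poly_Mapping.map ((*) c) u) = (\<lambda>m. c * \<psi> u m)" if "u \<in> ?P" for u c
    using lin that by (simp add: linear_map_def partition_algebra_simps(6) QSym_simps rat_field_simps)
  let ?t = "\<lambda>C. Poly_Mapping.single C (Poly_Mapping.lookup x C)"
  have single: "Poly_Mapping.single C 1 \<in> ?P" "\<psi> (Poly_Mapping.single C 1) = T (class_comp C)"
    if C: "C \<in> Succ_classes" for C
  proof -
    obtain \<pi> where "\<pi> \<in> all_set_partitions" "C = st_class Succ \<pi>" using C by blast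
    then show "Poly_Mapping.single C 1 \<in> ?P" "\<psi> (Poly_Mapping.single C 1) = T (class_comp C)"
      using basis partition_algebra_closed(5) by (auto simp: basis_elem_def class_comp_st_class)
  qed
  have "sum ?t A \<in> ?P \<and> \<psi> (sum ?t A) = (\<lambda>m. \<Sum>C\<in>A. Poly_Mapping.lookup x C * T (class_comp C) m)"
    if "finite A" "A \<subseteq> Succ_classes" for A
    using that
  proof (induction A rule: finite_induct)
    case empty
    \<comment> \<open>\<open>linear_map\<close> does not state that zero goes to zero; this is
      obtained by scaling with 0.\<close>
    have "Poly_Mapping.map ((*) (0::rat)) 0 = (0 :: nat set set set \<Rightarrow>\<^sub>0 rat)"
      by (rule poly_mapping_eqI) simp
    then have "\<psi> 0 = (\<lambda>m. 0)"
      using scale[OF partition_algebra_closed(1), of 0] by simp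
    then show ?case by (simp add: partition_algebra_closed)
  next
    case (insert C A)
    have "?t C = Poly_Mapping.map ((*) (Poly_Mapping.lookup x C)) (Poly_Mapping.single C 1)" by simp
    then have t: "?t C \<in> ?P" "\<psi> (?t C) = (\<lambda>m. Poly_Mapping.lookup x C * T (class_comp C) m)"
      using single[of C] insert.prems partition_algebra_closed(3) scale by (simp_all del: map_single)
    then show ?case
      using insert by (simp add: add partition_algebra_closed(2))
  qed
  from this[of "Poly_Mapping.keys x"]
  have "\<psi> (sum ?t (Poly_Mapping.keys x)) = \<phi> x"
    using x by (simp add: \<phi>_def lin_ext_def partition_algebra_simps)
  then show ?thesis
    using poly_mapping_eq_sum_single[of x] by simp
qed

text \<open>All members of the arc-shuffle have the same size, so their images depend only on
  succession sets. The multiset of these equals the multiset of tie sets of interleavings, and the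
  tie basis rule does the rest.\<close>

lemma \<phi>_class_prod:
  assumes "C \<in> Succ_classes" "D \<in> Succ_classes"
  shows "\<phi> (class_prod Succ C D) = series_mult (T (class_comp C)) (T (class_comp D))"
proof
  fix m
  from assms(1) obtain \<tau> where \<tau>: "\<tau> \<in> all_set_partitions" "(SOME \<tau>. \<tau> \<in> C) = \<tau>" "C = st_class Succ \<tau>"
    by (rule class_representative)
  from assms(2) obtain \<theta> where \<theta>: "\<theta> \<in> all_set_partitions" "(SOME \<theta>. \<theta> \<in> D) = \<theta>" "D = st_class Succ \<theta>"
    by (rule class_representative)
  let ?\<alpha> = "class_comp C" and ?\<beta> = "class_comp D"
  let ?n = "part_size \<tau> + part_size \<theta>"
  let ?W = "shuffles (tie_word ?\<alpha>) (map ((+) (max_letter (tie_word ?\<alpha>))) (tie_word ?\<beta>))"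
  have comp: "?\<alpha> = Comp (part_size \<tau>) (Succ \<tau>)" "?\<beta> = Comp (part_size \<theta>) (Succ \<theta>)"
    using \<tau> \<theta> by (simp_all add: class_comp_st_class)
  have len: "length v = ?n" if "v \<in> ?W" for v
    using length_shuffles[OF that] by (simp add: comp sum_list_Comp[OF Succ_subset])
  have "\<phi> (class_prod Succ C D) m = (\<Sum>\<pi>\<in>#arc_shuffle \<tau> \<theta>. \<phi> (basis_elem Succ \<pi>) m)"
    unfolding class_prod_def \<tau>(2) \<theta>(2) \<phi>_def lin_ext_sum_mset ..
  also have "image_mset (\<lambda>\<pi>. \<phi> (basis_elem Succ \<pi>) m) (arc_shuffle \<tau> \<theta>) =
      image_mset (\<lambda>\<pi>. T (Comp ?n (Succ \<pi>)) m) (arc_shuffle \<tau> \<theta>)"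
  proof (rule image_mset_cong)
    fix \<pi> assume "\<pi> \<in># arc_shuffle \<tau> \<theta>"
    with \<tau>(1) \<theta>(1) have "\<pi> \<in> all_set_partitions" "part_size \<pi> = ?n"
      by (rule arc_shuffle_closed, rule part_size_arc_shuffle)
    then show "\<phi> (basis_elem Succ \<pi>) m = T (Comp ?n (Succ \<pi>)) m" by (simp add: \<phi>_basis_elem)
  qed
  also have "\<dots> = image_mset (\<lambda>S. T (Comp ?n S) m) (image_mset Succ (arc_shuffle \<tau> \<theta>))"
    by (simp add: multiset.map_comp comp_def)
  also have "\<dots> = image_mset (\<lambda>v. T (Comp ?n (Tie v)) m) (mset_set ?W)"
    unfolding image_Succ_arc_shuffle_shuffles[OF \<tau>(1) \<theta>(1)] comp
    by (simp add: multiset.map_comp comp_def)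
  also have "sum_mset \<dots> = (\<Sum>v\<in>?W. T (Comp ?n (Tie v)) m)"
    by (simp add: sum_unfold_sum_mset)
  also have "\<dots> = (\<Sum>v\<in>?W. T (Comp (length v) (Tie v)) m)"
    using len by (intro sum.cong) auto
  also have "\<dots> = series_mult (T ?\<alpha>) (T ?\<beta>) m"
    using assms by (simp add: series_mult_T composition_class_comp)
  finally show "\<phi> (class_prod Succ C D) m = series_mult (T ?\<alpha>) (T ?\<beta>) m" .
qed

lemma \<phi>_mult:
  assumes "x \<in> carrier (partition_algebra Succ)" "y \<in> carrier (partition_algebra Succ)"
  shows "\<phi> (x \<otimes>\<^bsub>partition_algebra Succ\<^esub> y) = series_mult (\<phi> x) (\<phi> y)"
proof
  fix m
  have "\<phi> (x \<otimes>\<^bsub>partition_algebra Succ\<^esub> y) m = (\<Sum>C\<in>Poly_Mapping.keys x. \<Sum>D\<in>Poly_Mapping.keys y.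
      Poly_Mapping.lookup x C * Poly_Mapping.lookup y D * \<phi> (class_prod Succ C D) m)"
    unfolding partition_algebra_simps \<phi>_def lin_ext_sum lin_ext_scale ..
  also have "\<dots> = (\<Sum>C\<in>Poly_Mapping.keys x. \<Sum>D\<in>Poly_Mapping.keys y.
      Poly_Mapping.lookup x C * Poly_Mapping.lookup y D *
        series_mult (T (class_comp C)) (T (class_comp D)) m)"
    using assms by (intro sum.cong refl arg_cong2[where f = "(*)"] fun_cong[OF \<phi>_class_prod])
      (auto simp: partition_algebra_simps)
  also have "\<dots> = series_mult (\<phi> x) (\<phi> y) m"
    unfolding \<phi>_def series_mult_lin_ext ..
  finally show "\<phi> (x \<otimes>\<^bsub>partition_algebra Succ\<^esub> y) m = series_mult (\<phi> x) (\<phi> y) m" .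
qed

lemma \<phi>_eq_0:
  assumes x: "x \<in> carrier (partition_algebra Succ)" and "\<phi> x = (\<lambda>m. 0)"
  shows "x = 0"
proof -
  \<comment> \<open>The coefficients of x moved to compositions. Since \<open>class_comp\<close> is
    injective on classes, no two of them merge, so \<open>?c = 0\<close> forces every coefficient of
    x to vanish.\<close>
  let ?c = "\<Sum>C\<in>Poly_Mapping.keys x. Poly_Mapping.single (class_comp C) (Poly_Mapping.lookup x C)"
  have keys: "Poly_Mapping.keys x \<subseteq> Succ_classes" using x by (simp add: partition_algebra_simps)
  have "Poly_Mapping.keys ?c \<subseteq> {\<alpha>. composition \<alpha>}"
  proof (rule keys_sum_subset)
    fix C assume "C \<in> Poly_Mapping.keys x"
    then have "composition (class_comp C)" using keys by (intro composition_class_comp) (rule subsetD)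
    then show "Poly_Mapping.keys (Poly_Mapping.single (class_comp C) (Poly_Mapping.lookup x C)) \<subseteq> {\<alpha>. composition \<alpha>}"
      by simp
  qed
  moreover have "lin_ext T ?c = (\<lambda>m. 0)"
    using assms(2) unfolding lin_ext_sum lin_ext_single unfolding \<phi>_def lin_ext_def .
  ultimately have "?c = 0" by (rule lin_ext_T_eq_0)
  show ?thesis
  proof (rule poly_mapping_eqI)
    fix D
    show "Poly_Mapping.lookup x D = Poly_Mapping.lookup 0 D"
    proof (cases "D \<in> Poly_Mapping.keys x")
      case True
      have "0 = Poly_Mapping.lookup ?c (class_comp D)" using \<open>?c = 0\<close> by simp
      also have "\<dots> = (\<Sum>C\<in>Poly_Mapping.keys x. if C = D then Poly_Mapping.lookup x D else 0)"
        unfolding lookup_sum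
      proof (rule sum.cong[OF refl])
        fix C assume "C \<in> Poly_Mapping.keys x"
        then have "C \<in> Succ_classes" "D \<in> Succ_classes" using True by (auto dest: subsetD[OF keys])
        then have "class_comp C = class_comp D \<longleftrightarrow> C = D"
          by (rule inj_on_eq_iff[OF bij_betw_imp_inj_on[OF bij_betw_class_comp]])
        then show "Poly_Mapping.lookup (Poly_Mapping.single (class_comp C) (Poly_Mapping.lookup x C)) (class_comp D) =
            (if C = D then Poly_Mapping.lookup x D else 0)"
          by (auto simp: lookup_single when_def)
      qed
      also have "\<dots> = Poly_Mapping.lookup x D" using True by simp
      finally show ?thesis by simp
    qed (simp add: in_keys_iff)
  qed
qed

lemma bij_betw_\<phi>: "bij_betw \<phi> (carrier (partition_algebra Succ)) (carrier QSym)"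
proof (rule bij_betw_imageI)
  show "inj_on \<phi> (carrier (partition_algebra Succ))"
  proof (rule inj_onI)
    fix x y assume xy: "x \<in> carrier (partition_algebra Succ)" "y \<in> carrier (partition_algebra Succ)"
      "\<phi> x = \<phi> y"
    have "x + - y \<in> carrier (partition_algebra Succ)"
      using xy by (intro partition_algebra_closed(2)) (auto simp: partition_algebra_simps keys_minus)
    moreover have "\<phi> (x + - y) = (\<lambda>m. 0)"
      using xy(3) unfolding \<phi>_def lin_ext_add lin_ext_uminus by simp
    ultimately have "x + - y = 0" by (rule \<phi>_eq_0)
    then show "x = y" by simp
  qed
  have "f \<in> \<phi> ` carrier (partition_algebra Succ)" if f: "quasisymmetric f" for f
  proof -
    obtain c where c: "Poly_Mapping.keys c \<subseteq> {\<alpha>. composition \<alpha>}" "f = lin_ext T c"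
      using ex1_lin_ext_T[OF f] by blast
    define cls where "cls = the_inv_into Succ_classes class_comp"
    have cls: "cls \<alpha> \<in> Succ_classes" "class_comp (cls \<alpha>) = \<alpha>" if "\<alpha> \<in> Poly_Mapping.keys c" for \<alpha>
    proof -
      have "\<alpha> \<in> class_comp ` Succ_classes" "inj_on class_comp Succ_classes"
        using bij_betw_class_comp c(1) that by (auto simp: bij_betw_def)
      then show "cls \<alpha> \<in> Succ_classes" "class_comp (cls \<alpha>) = \<alpha>"
        unfolding cls_def by (auto intro: the_inv_into_into f_the_inv_into_f)
    qed
    \<comment> \<open>The preimage carries the coefficients of f in the tie basis, moved back to
      classes by the inverse of \<open>class_comp\<close>.\<close>
    let ?x = "\<Sum>\<alpha>\<in>Poly_Mapping.keys c. Poly_Mapping.single (cls \<alpha>) (Poly_Mapping.lookup c \<alpha>)"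
    have "?x \<in> carrier (partition_algebra Succ)"
      unfolding partition_algebra_simps mem_Collect_eq
      by (rule keys_sum_subset) (simp add: cls(1))
    moreover have "\<phi> ?x = f"
      unfolding c(2) \<phi>_def lin_ext_sum lin_ext_single unfolding lin_ext_def
      using cls(2) by (intro ext sum.cong) auto
    ultimately show ?thesis by blast
  qed
  then show "\<phi> ` carrier (partition_algebra Succ) = carrier QSym"
    using \<phi>_closed by (auto simp: QSym_simps)
qed

text \<open>The tie basis makes \<open>QSym\<close> an algebra; pulling it back along the bijection
  \<psi> makes the partition algebra one, and \<psi> is then a ring isomorphism.\<close>

lemma algebra_iso:
  assumes lin: "linear_map rat_field (partition_algebra Succ) QSym \<psi>"
    and basis: "\<And>\<pi>. \<pi> \<in> all_set_partitions \<Longrightarrow> \<psi> (basis_elem Succ \<pi>) = T (Comp (part_size \<pi>) (Succ \<pi>))"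
  shows "algebra_iso rat_field (partition_algebra Succ) QSym \<psi>"
proof -
  let ?P = "carrier (partition_algebra Succ)"
  have eq: "\<psi> x = \<phi> x" if "x \<in> ?P" for x using lin basis that by (rule linear_map_unique)
  have bij: "bij_betw \<psi> ?P (carrier QSym)"
    using bij_betw_\<phi> eq by (simp cong: bij_betw_cong)
  have mult: "\<psi> (x \<otimes>\<^bsub>partition_algebra Succ\<^esub> y) = \<psi> x \<otimes>\<^bsub>QSym\<^esub> \<psi> y" if "x \<in> ?P" "y \<in> ?P" for x y
    using that by (simp add: eq \<phi>_mult partition_algebra_closed(4) QSym_simps(2))
  \<comment> \<open>The unit is the class of the empty partition; \<open>Comp\<close> is empty at
    size 0, and \<open>T []\<close> is the unit series.\<close>
  have one: "\<psi> \<one>\<^bsub>partition_algebra Succ\<^esub> = \<one>\<^bsub>QSym\<^esub>"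
    using basis[OF empty_set_partition(1)]
    by (simp add: empty_set_partition(2,3) partition_algebra_simps(3) QSym_simps(3) Comp_def T_Nil)
  have zero: "\<psi> \<zero>\<^bsub>partition_algebra Succ\<^esub> = \<zero>\<^bsub>QSym\<^esub>"
    using eq[OF partition_algebra_closed(1)] by (simp add: partition_algebra_simps(4) QSym_simps(4) \<phi>_def)
  have add: "\<psi> (x \<oplus>\<^bsub>partition_algebra Succ\<^esub> y) = \<psi> x \<oplus>\<^bsub>QSym\<^esub> \<psi> y" if "x \<in> ?P" "y \<in> ?P" for x y
    using lin that by (simp add: linear_map_def)
  have smult: "\<psi> (c \<odot>\<^bsub>partition_algebra Succ\<^esub> x) = c \<odot>\<^bsub>QSym\<^esub> \<psi> x" if "c \<in> carrier rat_field" "x \<in> ?P" for c x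
    using lin that by (simp add: linear_map_def)
  have "algebra rat_field (partition_algebra Succ)"
    using is_algebra bij
    by (rule algebra_pullback)
      (use partition_algebra_closed empty_set_partition(1) mult one zero add smult in
        \<open>simp_all add: partition_algebra_simps(3-6)\<close>)
  moreover have "\<psi> \<in> ring_iso (partition_algebra Succ) QSym"
    using bij mult add one by (auto intro!: ring_iso_memI dest: bij_betw_apply)
  ultimately show ?thesis
    using is_algebra lin by (simp add: algebra_iso_def)
qed

end

text \<open>Existence of the linear map stands beside the claim about all such maps, which therefore
  is not vacuous.\<close>

theorem theorem5p4:
  "weakly_shuffle_compatible Succ \<and>
   (\<forall>T. tie_basis T \<longrightarrow>
      (\<exists>\<phi>. linear_map rat_field (partition_algebra Succ) QSym \<phi> \<and>
         (\<forall>\<pi>\<in>all_set_partitions. \<phi> (basis_elem Succ \<pi>) = T (Comp (part_size \<pi>) (Succ \<pi>)))) \<and>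
      (\<forall>\<phi>. linear_map rat_field (partition_algebra Succ) QSym \<phi> \<and>
         (\<forall>\<pi>\<in>all_set_partitions. \<phi> (basis_elem Succ \<pi>) = T (Comp (part_size \<pi>) (Succ \<pi>))) \<longrightarrow>
         algebra_iso rat_field (partition_algebra Succ) QSym \<phi>))"
proof (intro conjI allI impI)
  show "weakly_shuffle_compatible Succ" by (rule weakly_shuffle_compatible_Succ)
next
  fix T assume "tie_basis T"
  then interpret tie_basis_of_QSym T by unfold_locales
  show "\<exists>\<phi>. linear_map rat_field (partition_algebra Succ) QSym \<phi> \<and>
      (\<forall>\<pi>\<in>all_set_partitions. \<phi> (basis_elem Succ \<pi>) = T (Comp (part_size \<pi>) (Succ \<pi>)))"
    using linear_map_\<phi> \<phi>_basis_elem by blast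
next
  fix T \<phi> assume "tie_basis T" and \<phi>: "linear_map rat_field (partition_algebra Succ) QSym \<phi> \<and>
    (\<forall>\<pi>\<in>all_set_partitions. \<phi> (basis_elem Succ \<pi>) = T (Comp (part_size \<pi>) (Succ \<pi>)))"
  then interpret tie_basis_of_QSym T by unfold_locales
  show "algebra_iso rat_field (partition_algebra Succ) QSym \<phi>"
    using \<phi> by (intro algebra_iso) auto
qed

end
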